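(* Let $\varepsilon>0$. Then there exists a classical abstract Swiss cheese $B=((b_n,s_n))_{n\ge0}$ with $0\in X_B$ and $\rho(B)<\varepsilon$ and such that $R(X_B)$ is regular and admits a non-degenerate bounded point derivation of infinite order at $0$.
   Context: Notation: $\mathbb R^+=[0,\infty)$, $\mathbb N=\{1,2,\dots\}$, $\mathbb N_0=\{0,1,2,\dots\}$. For $a\in\mathbb C$, $r>0$, $B(a,r)$ and $\bar B(a,r)$ are the open and closed disks of centre $a$ and radius $r$; $B(a,0)=\emptyset$ and $\bar B(a,0)=\{a\}$. An abstract Swiss cheese is a sequence $A=((a_n,r_n))_{n\ge0}\in(\mathbb C\times\mathbb R^+)^{\mathbb N_0}$. Put $S_A=\{n\in\mathbb N:r_n>0\}$, $X_A=\bar B(a_0,r_0)\setminus\bigcup_{n=1}^\infty B(a_n,r_n)$, $\rho(A)=\sum_{n=1}^\infty r_n$. $A$ is classical if $\sum_{n\ge1}r_n<\infty$, $r_0>0$, and for all $k\in S_A$: $\bar B(a_k,r_k)\subseteq B(a_0,r_0)$, and $\bar B(a_k,r_k)\cap\bar B(a_\ell,r_\ell)=\emptyset$ for all $\ell\in S_A$ with $\ell\ne k$. For a non-empty compact $X\subseteq\mathbb C$, $R(X)$ is the set of continuous functions $f:X\to\mathbb C$ that can be uniformly approximated on $X$ by rational functions with no poles on $X$, with the uniform norm. $R(X)$ is regular if for every closed set $E\subseteq X$ and every $x\in X\setminus E$ there exists $f\in R(X)$ with $f(x)=1$ and $f(y)=0$ for all $y\in E$. A point derivation of infinite order at $x\in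 X$ (on $R(X)$) is a sequence $d_0,d_1,d_2,\dots$ of linear functionals on $R(X)$ with $d_0(f)=f(x)$ and $d_j(fg)=\sum_{k=0}^j d_k(f)d_{j-k}(g)$ for all $f,g\in R(X)$ and all $j=1,2,\dots$. It is bounded if every $d_j$ is a bounded linear functional, and non-degenerate if $d_1\neq0$. *)

theory Defs
  imports "HOL-Analysis.Analysis" "HOL-Computational_Algebra.Polynomial"
begin

section \<open>Abstract Swiss cheeses\<close>

text \<open>A sequence of pairs (centre, radius). Disks are the library's \<^const>\<open>ball\<close> and
  \<^const>\<open>cball\<close>, which for radius zero are the empty set and a singleton respectively.\<close>

definition abstract_swiss_cheese :: "(nat \<Rightarrow> complex \<times> real) \<Rightarrow> bool" where
  "abstract_swiss_cheese A \<longleftrightarrow> (\<forall>n. 0 \<le> snd (A n))"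

definition cheese_index :: "(nat \<Rightarrow> complex \<times> real) \<Rightarrow> nat set" where
  "cheese_index A = {n. 1 \<le> n \<and> 0 < snd (A n)}"

definition cheese_set :: "(nat \<Rightarrow> complex \<times> real) \<Rightarrow> complex set" where
  "cheese_set A = cball (fst (A 0)) (snd (A 0)) - (\<Union>n\<in>{1..}. ball (fst (A n)) (snd (A n)))"

text \<open>The sum of the radii is real-valued, so it is only meaningful if the radii are summable;
  this is part of being classical.\<close>

definition cheese_rho :: "(nat \<Rightarrow> complex \<times> real) \<Rightarrow> real" where
  "cheese_rho A = (\<Sum>n. snd (A (Suc n)))"

definition classical_cheese :: "(nat \<Rightarrow> complex \<times> real) \<Rightarrow> bool" where
  "classical_cheese A \<longleftrightarrow>
     abstract_swiss_cheese A \<and>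
     summable (\<lambda>n. snd (A (Suc n))) \<and>
     0 < snd (A 0) \<and>
     (\<forall>k\<in>cheese_index A.
        cball (fst (A k)) (snd (A k)) \<subseteq> ball (fst (A 0)) (snd (A 0)) \<and>
        (\<forall>l\<in>cheese_index A. l \<noteq> k \<longrightarrow>
           cball (fst (A k)) (snd (A k)) \<inter> cball (fst (A l)) (snd (A l)) = {}))"


section \<open>The uniform algebra \<open>R(X)\<close>\<close>

text \<open>A function on \<open>X\<close> is represented by the total function that extends it by zero. Equality of
  representatives is then equality on \<open>X\<close>, the algebra operations are pointwise, and a map
  on \<open>R(X)\<close> cannot depend on values off \<open>X\<close>. A rational function without poles on \<open>X\<close> is,
  in lowest terms, a quotient of polynomials whose denominator has no zero on \<open>X\<close>;
  allowing common factors with no zero on \<open>X\<close> does not change the set of functions.\<close>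

definition R_alg :: "complex set \<Rightarrow> (complex \<Rightarrow> complex) set" where
  "R_alg X = {f. (\<forall>z. z \<notin> X \<longrightarrow> f z = 0) \<and> continuous_on X f \<and>
     (\<forall>e>0. \<exists>p q. (\<forall>z\<in>X. poly q z \<noteq> 0) \<and>
        (\<forall>z\<in>X. cmod (f z - poly p z / poly q z) < e))}"

definition sup_norm_on :: "complex set \<Rightarrow> (complex \<Rightarrow> complex) \<Rightarrow> real" where
  "sup_norm_on X f = (SUP z\<in>X. cmod (f z))"

definition R_regular :: "complex set \<Rightarrow> bool" where
  "R_regular X \<longleftrightarrow>
     (\<forall>E x. E \<subseteq> X \<and> closed E \<and> x \<in> X - E \<longrightarrow>
        (\<exists>f\<in>R_alg X. f x = 1 \<and> (\<forall>y\<in>E. f y = 0)))"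


section \<open>Point derivations of infinite order\<close>

text \<open>Functionals on \<open>R(X)\<close> are total maps of which only the values on \<^term>\<open>R_alg X\<close> matter.\<close>

definition linear_functional_R :: "complex set \<Rightarrow> ((complex \<Rightarrow> complex) \<Rightarrow> complex) \<Rightarrow> bool" where
  "linear_functional_R X \<phi> \<longleftrightarrow>
     (\<forall>f\<in>R_alg X. \<forall>g\<in>R_alg X. \<phi> (\<lambda>z. f z + g z) = \<phi> f + \<phi> g) \<and>
     (\<forall>c. \<forall>f\<in>R_alg X. \<phi> (\<lambda>z. c * f z) = c * \<phi> f)"

definition bounded_functional_R :: "complex set \<Rightarrow> ((complex \<Rightarrow> complex) \<Rightarrow> complex) \<Rightarrow> bool" where
  "bounded_functional_R X \<phi> \<longleftrightarrow>
     (\<exists>C. \<forall>f\<in>R_alg X. cmod (\<phi> f) \<le> C * sup_norm_on X f)"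

definition point_derivation_inf ::
  "complex set \<Rightarrow> complex \<Rightarrow> (nat \<Rightarrow> (complex \<Rightarrow> complex) \<Rightarrow> complex) \<Rightarrow> bool" where
  "point_derivation_inf X x d \<longleftrightarrow>
     x \<in> X \<and>
     (\<forall>j. linear_functional_R X (d j)) \<and>
     (\<forall>f\<in>R_alg X. d 0 f = f x) \<and>
     (\<forall>j\<ge>1. \<forall>f\<in>R_alg X. \<forall>g\<in>R_alg X.
        d j (\<lambda>z. f z * g z) = (\<Sum>k=0..j. d k f * d (j - k) g))"

definition bounded_derivation ::
  "complex set \<Rightarrow> (nat \<Rightarrow> (complex \<Rightarrow> complex) \<Rightarrow> complex) \<Rightarrow> bool" where
  "bounded_derivation X d \<longleftrightarrow> (\<forall>j. bounded_functional_R X (d j))"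

definition nondegenerate_derivation ::
  "complex set \<Rightarrow> (nat \<Rightarrow> (complex \<Rightarrow> complex) \<Rightarrow> complex) \<Rightarrow> bool" where
  "nondegenerate_derivation X d \<longleftrightarrow> (\<exists>f\<in>R_alg X. d 1 f \<noteq> 0)"

end

theory Submission
  imports Defs "HOL-Complex_Analysis.Complex_Analysis" "HOL-Real_Asymp.Real_Asymp"
    "HOL-Library.Nat_Bijection"
begin

text \<open>For a disk with centre \<open>c\<close> and radius \<open>\<rho>\<close> take radii \<open>R k\<close> increasing to \<open>\<rho>\<close> and the infinite
  product of the functions \<open>1 / (1 - ((z - c) / R k) ^ N k)\<close>. Off small disks around the poles and for
  rapidly growing \<open>N k\<close> it converges uniformly to a function that vanishes exactly outside the disk:
  beyond the \<open>k\<close>-th circle the \<open>k\<close>-th factor is so small that it outweighs the size of the next factor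
  near its poles (McKissick, Koerner). Doing this for a countable base of disks whose boundaries
  avoid \<open>0\<close> makes \<open>R(X)\<close> regular. The groups of holes are ordered by size, a hole being much larger
  than the total size of all later groups; hence its radius can be chosen so that its boundary
  circle misses all later holes. Dropping the swallowed holes leaves a classical Swiss cheese.
  Since the radii are tiny compared with all powers of the distance to \<open>0\<close>, the Cauchy integrals of
  \<open>f(z) / z ^ (j + 1)\<close> over all boundary circles converge absolutely and extend the Taylor
  coefficients at \<open>0\<close> from rational functions to bounded functionals on \<open>R(X)\<close>.\<close>

section \<open>Roots of unity and avoiding intervals\<close>

text \<open>If \<open>w ^ N\<close> is near 1, its principal logarithm divided by \<open>N\<close>
  yields an \<open>N\<close>-th root \<open>exp t\<close> of it near 1. Then
  \<open>w / exp t\<close> is a root of unity at distance \<open>cmod (exp t - 1)\<close> from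
  \<open>w\<close>, and this is at most \<open>4 * cmod (w ^ N - 1) / N\<close>. If
  \<open>w ^ N\<close> is not near 1, \<open>small\<close> suffices.\<close>

lemma norm_one_minus_power_ge:
  fixes w :: complex
  assumes N: "0 < N" and sep: "\<And>\<omega>. \<omega> ^ N = 1 \<Longrightarrow> \<delta> \<le> cmod (w - \<omega>)"
    and small: "real N * \<delta> \<le> 1"
  shows "real N * \<delta> / 4 \<le> cmod (1 - w ^ N)"
proof (cases "cmod (w ^ N - 1) < 1/4")
  case False
  then show ?thesis using small by (simp add: norm_minus_commute)
next
  case True
  define v where "v = w ^ N"
  have v1: "cmod (v - 1) < 1/4" using True by (simp add: v_def)
  hence v0: "v \<noteq> 0" by auto
  define s where "s = Ln v"
  define t where "t = s / of_nat N"
  have s: "cmod s \<le> 2 * cmod (v - 1)"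
    using norm_Ln_le[of "v - 1"] v1 by (simp add: s_def)
  have t: "cmod t = cmod s / real N" by (simp add: t_def norm_divide)
  have s1: "cmod s < 1/2" using s v1 by linarith
  have "cmod t \<le> cmod s" using t N by (simp add: divide_le_eq mult_le_cancel_left1)
  hence t1: "cmod t \<le> 1/2" using s1 by simp
  have et: "exp t ^ N = v"
    using v0 N by (simp add: t_def s_def exp_of_nat_mult[symmetric])
  define \<omega> where "\<omega> = w / exp t"
  have "\<omega> ^ N = 1" using et v0 by (simp add: \<omega>_def power_divide v_def)
  hence "\<delta> \<le> cmod (w - \<omega>)" and n1: "cmod \<omega> = 1"
    using sep N power_eq_1_iff[of \<omega> N] by auto
  moreover have "w - \<omega> = \<omega> * (exp t - 1)" by (simp add: \<omega>_def field_simps)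
  ultimately have d: "\<delta> \<le> cmod (exp t - 1)" by (simp add: norm_mult)
  have "cmod (exp t - 1) \<le> 2 * cmod t"
    using norm_exp_bounds(2)[OF t1] norm_ge_zero[of t] by linarith
  hence "\<delta> \<le> 2 * (cmod s / real N)"
    using d t by linarith
  hence "real N * \<delta> \<le> 2 * cmod s"
    using N by (simp add: field_simps)
  then show ?thesis using s by (simp add: v_def norm_minus_commute)
qed

text \<open>The powers \<open>\<omega> ^ s\<close> with \<open>s < N\<close> sum to zero, so the
  differences \<open>\<omega> ^ s - 1\<close> sum to \<open>- N\<close>. Each has modulus at most
  \<open>s * cmod (\<omega> - 1)\<close>, and these bounds add up to at most
  \<open>N * N / 2 * cmod (\<omega> - 1)\<close>.\<close>

lemma roots_of_unity_separated:
  fixes \<omega> :: complex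
  assumes N: "0 < N" and w: "\<omega> ^ N = 1" "\<omega> \<noteq> 1"
  shows "2 \<le> real N * cmod (\<omega> - 1)"
proof -
  have n1: "cmod \<omega> = 1" using N w power_eq_1_iff by auto
  have *: "cmod (\<omega> ^ s - 1) \<le> real s * cmod (\<omega> - 1)" for s
  proof (induction s)
    case (Suc s)
    have "\<omega> ^ Suc s - 1 = \<omega> * (\<omega> ^ s - 1) + (\<omega> - 1)" by (simp add: algebra_simps)
    hence "cmod (\<omega> ^ Suc s - 1) \<le> cmod (\<omega> ^ s - 1) + cmod (\<omega> - 1)"
      by (metis n1 norm_mult mult_1 norm_triangle_ineq)
    then show ?case using Suc by (simp add: algebra_simps)
  qed simp
  have "(\<Sum>s<N. \<omega> ^ s) = 0" using w by (simp add: geometric_sum)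
  hence "(\<Sum>s<N. \<omega> ^ s - 1) = - of_nat N" by (simp add: sum_subtractf)
  hence "real N = cmod (\<Sum>s<N. \<omega> ^ s - 1)" by simp
  also have "\<dots> \<le> (\<Sum>s<N. real s * cmod (\<omega> - 1))" by (rule sum_norm_le) (use * in auto)
  also have "\<dots> = (\<Sum>s<N. real s) * cmod (\<omega> - 1)" by (simp add: sum_distrib_right)
  also have "(\<Sum>s<N. real s) \<le> real N * real N / 2" by (induction N) (auto simp: field_simps)
  finally have "real N \<le> real N * real N / 2 * cmod (\<omega> - 1)"
    by (simp add: mult_right_mono)
  then show ?thesis using N by (simp add: field_simps)
qed

text \<open>By countable subadditivity of Lebesgue measure, intervals of total length below
  \<open>L\<close> cannot cover an interval of length \<open>L\<close>. Entries with
  \<open>y n = 0\<close> are padding and exclude nothing.\<close>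

lemma interval_not_covered:
  fixes x y :: "nat \<Rightarrow> real"
  assumes "0 < L" and y0: "\<And>n. 0 \<le> y n" and sm: "summable y" and lt: "2 * suminf y < L"
  obtains r where "a \<le> r" "r \<le> a + L" "\<And>n. y n < \<bar>r - x n\<bar> \<or> y n = 0"
proof -
  define I where "I n = (if y n = 0 then {} else {x n - y n .. x n + y n})" for n
  have em: "emeasure lborel (I n) = ennreal (2 * y n)" for n
    using y0[of n] by (auto simp: I_def)
  have "emeasure lborel (\<Union>n. I n) \<le> (\<Sum>n. emeasure lborel (I n))"
    by (rule emeasure_subadditive_countably) (auto simp: I_def)
  also have "\<dots> = (\<Sum>n. ennreal (2 * y n))" by (simp add: em)
  also have "\<dots> = ennreal (\<Sum>n. 2 * y n)"
    using y0 sm by (intro suminf_ennreal2) (auto intro: summable_mult)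
  also have "(\<Sum>n. 2 * y n) = 2 * suminf y" using sm by (rule suminf_mult)
  also have "ennreal (2 * suminf y) < ennreal L" using lt assms(1) by (simp add: ennreal_lessI)
  also have "ennreal L = emeasure lborel {a..a+L}" using assms(1) by simp
  finally have "\<not> {a..a+L} \<subseteq> (\<Union>n. I n)"
    using emeasure_mono[of "{a..a+L}" "\<Union>n. I n" lborel]
    by (auto simp: I_def split: if_splits)
  then obtain r where r: "r \<in> {a..a+L}" "r \<notin> (\<Union>n. I n)" by blast
  show ?thesis
  proof (rule that[of r])
    fix n
    have "r \<notin> I n" using r(2) by blast
    thus "y n < \<bar>r - x n\<bar> \<or> y n = 0" by (simp add: I_def split: if_splits) linarith
  qed (use r in auto)
qed

lemma summable_prod_decode:
  fixes g :: "nat \<times> nat \<Rightarrow> real" and N :: "nat \<Rightarrow> nat"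
  assumes g0: "\<And>j i. 0 \<le> g (j, i)" and z: "\<And>j i. N j \<le> i \<Longrightarrow> g (j, i) = 0"
    and le: "\<And>j i. i < N j \<Longrightarrow> g (j, i) \<le> u j"
    and sm: "summable (\<lambda>j. real (N j) * u j)"
  shows "summable (\<lambda>n. g (prod_decode n))"
    and "(\<Sum>n. g (prod_decode n)) \<le> (\<Sum>j. real (N j) * u j)"
proof -
  have gg: "0 \<le> g z" for z using g0 by (cases z) auto
  have gz: "g p = 0" if "\<not> snd p < N (fst p)" for p
    using z[of "fst p" "snd p"] that by simp
  have Nu: "0 \<le> real (N j) * u j" for j
    using g0[of j 0] le[of 0 j] by (cases "N j = 0") auto
  have bound: "(\<Sum>n<M. g (prod_decode n)) \<le> (\<Sum>j. real (N j) * u j)" for M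
  proof -
    obtain J where J: "fst ` prod_decode ` {..<M} \<subseteq> {..<J}"
      by (metis finite_imageI finite_lessThan finite_nat_iff_bounded)
    have "(\<Sum>n<M. g (prod_decode n)) = (\<Sum>z\<in>prod_decode ` {..<M}. g z)"
      by (subst sum.reindex) (auto intro: inj_prod_decode)
    also have "\<dots> = (\<Sum>z\<in>prod_decode ` {..<M} \<inter> {z. snd z < N (fst z)}. g z)"
      by (rule sum.mono_neutral_right) (auto simp: gz)
    also have "\<dots> \<le> (\<Sum>z\<in>(SIGMA j:{..<J}. {..<N j}). g z)"
    proof (rule sum_mono2)
      show "prod_decode ` {..<M} \<inter> {z. snd z < N (fst z)} \<subseteq> (SIGMA j:{..<J}. {..<N j})"
      proof
        fix p assume p: "p \<in> prod_decode ` {..<M} \<inter> {z. snd z < N (fst z)}"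
        hence "fst p \<in> {..<J}" using J by blast
        thus "p \<in> (SIGMA j:{..<J}. {..<N j})" using p by (cases p) auto
      qed
    qed (use gg in auto)
    also have "\<dots> = (\<Sum>j<J. \<Sum>i<N j. g (j, i))" by (subst sum.Sigma) auto
    also have "\<dots> \<le> (\<Sum>j<J. real (N j) * u j)"
      by (intro sum_mono order.trans[OF sum_bounded_above[of _ _ "u _"]]) (auto intro: le)
    also have "\<dots> \<le> (\<Sum>j. real (N j) * u j)" by (rule sum_le_suminf[OF sm]) (auto simp: Nu)
    finally show ?thesis .
  qed
  show "summable (\<lambda>n. g (prod_decode n))"
    by (rule summableI_nonneg_bounded[OF gg bound])
  then show "(\<Sum>n. g (prod_decode n)) \<le> (\<Sum>j. real (N j) * u j)"
    by (rule suminf_le_const) (rule bound)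
qed

section \<open>Taylor functionals on a classical Swiss cheese\<close>

text \<open>The weights are those of the Cauchy integrals of order \<open>j\<close>: the radius
  measures the length of a circle, the denominator bounds the kernel through the distance of the
  circle from \<open>x\<close>.\<close>

locale pointed_cheese =
  fixes B :: "nat \<Rightarrow> complex \<times> real" and x :: complex
  assumes classical: "classical_cheese B"
    and x_inside: "x \<in> ball (fst (B 0)) (snd (B 0))"
    and x_outside: "\<And>k. k \<in> cheese_index B \<Longrightarrow> x \<notin> cball (fst (B k)) (snd (B k))"
    and weighted_summable: "\<And>j. summable (\<lambda>n. snd (B (Suc n)) /
      \<bar>dist x (fst (B (Suc n))) - snd (B (Suc n))\<bar> ^ Suc j)"
begin

abbreviation "X \<equiv> cheese_set B"
abbreviation "ctr n \<equiv> fst (B n)"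
abbreviation "rad n \<equiv> snd (B n)"

text \<open>The distance from \<open>x\<close> to the \<open>n\<close>-th boundary circle. The
  absolute value is there because \<open>x\<close> lies inside the outer circle but outside the
  holes.\<close>

definition gap :: "nat \<Rightarrow> real" where "gap n = \<bar>dist x (ctr n) - rad n\<bar>"

text \<open>Radius zero is set apart because such entries are mere padding and may even be centred
  at \<open>x\<close>, where the kernel is singular.\<close>

definition circle_integral :: "nat \<Rightarrow> nat \<Rightarrow> (complex \<Rightarrow> complex) \<Rightarrow> complex" where
  "circle_integral n j f = (if 0 < rad n
     then contour_integral (circlepath (ctr n) (rad n)) (\<lambda>z. f z / (z - x) ^ Suc j) else 0)"

text \<open>Cauchy's formula for the \<open>j\<close>-th Taylor coefficient at \<open>x\<close>,
  taken over the whole boundary of \<open>X\<close>, the circles around holes being traversed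
  negatively.\<close>

definition taylor_functional :: "nat \<Rightarrow> (complex \<Rightarrow> complex) \<Rightarrow> complex" where
  "taylor_functional j f =
     (circle_integral 0 j f - (\<Sum>n. circle_integral (Suc n) j f)) / (2 * pi * \<i>)"

lemma rad_nonneg: "0 \<le> rad n"
  using classical by (simp add: classical_cheese_def abstract_swiss_cheese_def)

lemma gap_pos: "0 < rad n \<Longrightarrow> 0 < gap n"
  using x_inside x_outside[of n]
  by (cases n) (auto simp: gap_def cheese_index_def dist_commute)

lemma cheese_compact: "compact X"
  unfolding cheese_set_def by (rule compact_diff) auto

lemma x_in_cheese: "x \<in> X"
proof -
  have "x \<notin> ball (ctr n) (rad n)" if "n \<ge> 1" for n
  proof
    assume b: "x \<in> ball (ctr n) (rad n)"
    hence "0 < rad n" by (auto dest: le_less_trans[OF zero_le_dist])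
    hence "n \<in> cheese_index B" using that by (simp add: cheese_index_def)
    thus False using x_outside b ball_subset_cball by blast
  qed
  thus ?thesis using x_inside by (auto simp: cheese_set_def)
qed

lemma inner_disks_disjoint:
  assumes "n \<ge> 1" "m \<ge> 1" "n \<noteq> m" "z \<in> cball (ctr n) (rad n)" "0 < rad n"
  shows "z \<notin> ball (ctr m) (rad m)"
proof
  assume z: "z \<in> ball (ctr m) (rad m)"
  hence "0 < rad m" by (auto dest: le_less_trans[OF zero_le_dist])
  hence "n \<in> cheese_index B" "m \<in> cheese_index B" using assms by (auto simp: cheese_index_def)
  hence "cball (ctr n) (rad n) \<inter> cball (ctr m) (rad m) = {}"
    using classical assms(3) unfolding classical_cheese_def by blast
  thus False using z assms(4) ball_subset_cball by blast
qed

lemma inner_disk_subset: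
  "n \<ge> 1 \<Longrightarrow> cball (ctr n) (rad n) \<subseteq> ball (ctr 0) (rad 0)" if "0 < rad n"
  using classical that by (auto simp: classical_cheese_def cheese_index_def)

text \<open>Members of \<open>R_alg X\<close> carry information only on \<open>X\<close>, so the
  boundary integrals are meaningful only if no circle enters a hole. Disjointness of the closed
  holes and their position in the open outer disk ensure this.\<close>

lemma circle_subset:
  assumes "0 < rad n"
  shows "sphere (ctr n) (rad n) \<subseteq> X"
proof
  fix z assume z: "z \<in> sphere (ctr n) (rad n)"
  show "z \<in> X"
  proof (cases "n = 0")
    case True
    have "z \<notin> ball (ctr m) (rad m)" if m: "m \<ge> 1" for m
    proof
      assume zm: "z \<in> ball (ctr m) (rad m)"
      hence "0 < rad m" by (auto dest: le_less_trans[OF zero_le_dist])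
      hence "z \<in> ball (ctr 0) (rad 0)"
        using inner_disk_subset[of m] m zm ball_subset_cball by blast
      thus False using z True by simp
    qed
    thus ?thesis using z True by (auto simp: cheese_set_def)
  next
    case False
    hence "cball (ctr n) (rad n) \<subseteq> ball (ctr 0) (rad 0)"
      using inner_disk_subset[of n] assms by simp
    hence "z \<in> cball (ctr 0) (rad 0)"
      using z ball_subset_cball[of "ctr 0" "rad 0"] sphere_cball[of "ctr n" "rad n"] by (meson subsetD)
    moreover have "z \<notin> ball (ctr m) (rad m)" if m: "m \<ge> 1" for m
      using inner_disks_disjoint[of n m z] False m z assms by (cases "m = n") auto
    ultimately show ?thesis by (auto simp: cheese_set_def)
  qed
qed

lemma circle_gap:
  assumes "z \<in> sphere (ctr n) (rad n)"
  shows "gap n \<le> cmod (z - x)"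
  using assms norm_triangle_ineq3[of "x - ctr n" "z - ctr n"]
  by (simp add: gap_def dist_norm norm_minus_commute)

lemma circle_integrable:
  assumes "continuous_on X f" "0 < rad n"
  shows "(\<lambda>z. f z / (z - x) ^ Suc j) contour_integrable_on circlepath (ctr n) (rad n)"
proof (rule contour_integrable_continuous_circlepath)
  have "continuous_on (sphere (ctr n) (rad n)) f"
    using assms circle_subset continuous_on_subset by blast
  moreover have "z - x \<noteq> 0" if "z \<in> sphere (ctr n) (rad n)" for z
    using circle_gap[OF that] gap_pos[OF assms(2)] by auto
  ultimately show "continuous_on (path_image (circlepath (ctr n) (rad n)))
      (\<lambda>z. f z / (z - x) ^ Suc j)"
    using assms(2) by (simp, intro continuous_intros) auto
qed

lemma circle_integral_bound:
  assumes f: "continuous_on X f" and M: "\<And>z. z \<in> X \<Longrightarrow> cmod (f z) \<le> M"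
  shows "cmod (circle_integral n j f) \<le> 2 * pi * M * (rad n / gap n ^ Suc j)"
proof (cases "0 < rad n")
  case True
  have M0: "0 \<le> M" using M[OF x_in_cheese] norm_ge_zero order.trans by blast
  have g: "0 < gap n" using True by (rule gap_pos)
  have "cmod (circle_integral n j f) \<le> (M / gap n ^ Suc j) * (2 * pi * rad n)"
  proof (rule has_contour_integral_bound_circlepath)
    show "((\<lambda>z. f z / (z - x) ^ Suc j) has_contour_integral circle_integral n j f)
        (circlepath (ctr n) (rad n))"
      using circle_integrable[OF f True] True
      by (simp add: circle_integral_def has_contour_integral_integral)
    fix z assume "cmod (z - ctr n) = rad n"
    hence z: "z \<in> sphere (ctr n) (rad n)" by (simp add: dist_norm norm_minus_commute)
    have "cmod (f z) \<le> M" using z circle_subset[OF True] M by blast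
    moreover have "gap n ^ Suc j \<le> cmod (z - x) ^ Suc j"
      using circle_gap[OF z] g by (intro power_mono) auto
    ultimately show "cmod (f z / (z - x) ^ Suc j) \<le> M / gap n ^ Suc j"
      unfolding norm_divide norm_power using g M0 by (intro frac_le) auto
  qed (use True M0 g in auto)
  thus ?thesis by (simp add: mult_ac)
next
  case False
  hence "rad n = 0" using rad_nonneg[of n] by simp
  then show ?thesis by (simp add: circle_integral_def)
qed

lemma continuous_bounded:
  assumes "continuous_on X f"
  obtains M where "\<And>z. z \<in> X \<Longrightarrow> cmod (f z) \<le> M"
proof -
  have "bounded (f ` X)" using assms cheese_compact compact_continuous_image compact_imp_bounded by blast
  thus ?thesis using that by (auto simp: bounded_iff)
qed

lemma summable_circle_integral:
  assumes f: "continuous_on X f"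
  shows "summable (\<lambda>n. cmod (circle_integral (Suc n) j f))"
proof -
  obtain M where M: "\<And>z. z \<in> X \<Longrightarrow> cmod (f z) \<le> M" by (rule continuous_bounded[OF f]) blast
  show ?thesis
  proof (rule summable_comparison_test')
    show "summable (\<lambda>n. 2 * pi * M * (rad (Suc n) / gap (Suc n) ^ Suc j))"
      using weighted_summable[of j] by (intro summable_mult) (simp add: gap_def)
  qed (use circle_integral_bound[OF f M] in auto)
qed

lemma taylor_functional_bound:
  "\<exists>C\<ge>0. \<forall>f M. continuous_on X f \<longrightarrow> (\<forall>z\<in>X. cmod (f z) \<le> M) \<longrightarrow>
    cmod (taylor_functional j f) \<le> C * M"
proof -
  define w where "w n = rad n / gap n ^ Suc j" for n
  define W where "W = (\<Sum>n. w (Suc n))"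
  have w0: "0 \<le> w n" for n using rad_nonneg[of n] by (simp add: w_def gap_def)
  have sw: "summable (\<lambda>n. w (Suc n))" using weighted_summable[of j] by (simp add: w_def gap_def)
  have "cmod (taylor_functional j f) \<le> (w 0 + W) * M"
    if f: "continuous_on X f" and M: "\<forall>z\<in>X. cmod (f z) \<le> M" for f M
  proof -
    have b: "cmod (circle_integral n j f) \<le> 2 * pi * M * w n" for n
      using circle_integral_bound[OF f, of M n j] M by (simp add: w_def)
    have "cmod (\<Sum>n. circle_integral (Suc n) j f) \<le> (\<Sum>n. cmod (circle_integral (Suc n) j f))"
      by (rule summable_norm[OF summable_circle_integral[OF f]])
    also have "\<dots> \<le> (\<Sum>n. 2 * pi * M * w (Suc n))"
      using b summable_circle_integral[OF f] summable_mult[OF sw] by (rule suminf_le)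
    also have "\<dots> = 2 * pi * M * W" unfolding W_def by (rule suminf_mult[OF sw])
    finally have "cmod (circle_integral 0 j f - (\<Sum>n. circle_integral (Suc n) j f))
        \<le> 2 * pi * M * w 0 + 2 * pi * M * W"
      using b[of 0] by (intro order.trans[OF norm_triangle_ineq4] add_mono)
    also have "\<dots> = 2 * pi * ((w 0 + W) * M)" by (simp add: algebra_simps)
    finally show ?thesis
      by (simp add: taylor_functional_def norm_divide norm_mult divide_le_eq mult_ac)
  qed
  moreover have "0 \<le> w 0 + W"
    unfolding W_def using w0 sw by (intro add_nonneg_nonneg suminf_nonneg) auto
  ultimately show ?thesis by blast
qed

lemma circle_integral_add:
  assumes "continuous_on X f" "continuous_on X g"
  shows "circle_integral n j (\<lambda>z. f z + g z) = circle_integral n j f + circle_integral n j g"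
  using contour_integral_add[OF circle_integrable[OF assms(1)] circle_integrable[OF assms(2)], of n j j]
  by (simp add: circle_integral_def add_divide_distrib)

lemma circle_integral_cmult:
  assumes "continuous_on X f"
  shows "circle_integral n j (\<lambda>z. c * f z) = c * circle_integral n j f"
  using contour_integral_lmul[OF circle_integrable[OF assms], of n c j]
  by (simp add: circle_integral_def)

lemma taylor_functional_add:
  assumes "continuous_on X f" "continuous_on X g"
  shows "taylor_functional j (\<lambda>z. f z + g z) = taylor_functional j f + taylor_functional j g"
  using suminf_add[OF summable_norm_cancel[OF summable_circle_integral[OF assms(1), of j]]
      summable_norm_cancel[OF summable_circle_integral[OF assms(2), of j]], symmetric]
  by (simp add: taylor_functional_def circle_integral_add[OF assms] diff_divide_distrib add_divide_distrib)

lemma taylor_functional_cmult: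
  assumes "continuous_on X f"
  shows "taylor_functional j (\<lambda>z. c * f z) = c * taylor_functional j f"
  using suminf_mult[OF summable_norm_cancel[OF summable_circle_integral[OF assms, of j]], of c]
  by (simp add: taylor_functional_def circle_integral_cmult[OF assms] field_simps)

lemma taylor_functional_tendsto:
  assumes F: "\<And>n. continuous_on X (F n)" and f: "continuous_on X f"
    and lim: "uniform_limit X F f sequentially"
  shows "(\<lambda>n. taylor_functional j (F n)) \<longlonglongrightarrow> taylor_functional j f"
proof -
  obtain C where C: "0 \<le> C" "\<And>f M. continuous_on X f \<Longrightarrow> (\<And>z. z \<in> X \<Longrightarrow> cmod (f z) \<le> M) \<Longrightarrow>
    cmod (taylor_functional j f) \<le> C * M" using taylor_functional_bound[of j] by auto
  have diff: "taylor_functional j (\<lambda>z. F n z + (-1) * f z) = taylor_functional j (F n) - taylor_functional j f" for n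
    using taylor_functional_add[OF F[of n], of "\<lambda>z. (-1) * f z"] taylor_functional_cmult[OF f, of j "-1"] f
    by (simp add: continuous_on_minus)
  show ?thesis
  proof (rule LIMSEQ_I)
    fix e :: real assume e: "0 < e"
    have "\<forall>\<^sub>F n in sequentially. \<forall>z\<in>X. dist (F n z) (f z) < e / (C + 1)"
      using lim e C(1) by (intro uniform_limitD) auto
    then obtain N where N: "\<And>n z. n \<ge> N \<Longrightarrow> z \<in> X \<Longrightarrow> dist (F n z) (f z) < e / (C + 1)"
      by (auto simp: eventually_sequentially)
    have "norm (taylor_functional j (F n) - taylor_functional j f) < e" if "n \<ge> N" for n
    proof -
      have "norm (taylor_functional j (F n) - taylor_functional j f) \<le> C * (e / (C + 1))"
        unfolding diff[symmetric]
        by (rule C(2)) (use N[OF that] F f in \<open>auto intro!: continuous_intros simp: dist_norm intro: less_imp_le\<close>)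
      \<comment> \<open>Dividing by \<open>C + 1\<close> instead of \<open>C\<close> covers the case
        \<open>C = 0\<close> and makes the inequality strict.\<close>
      also have "\<dots> < e" using C(1) e by (simp add: field_simps)
      finally show ?thesis .
    qed
    thus "\<exists>no. \<forall>n\<ge>no. norm (taylor_functional j (F n) - taylor_functional j f) < e" by blast
  qed
qed

section \<open>Taylor coefficients of rational functions by residues\<close>

lemma continuous_on_rational:
  assumes "\<And>z. z \<in> X \<Longrightarrow> poly q z \<noteq> 0"
  shows "continuous_on X (\<lambda>z. poly p z / poly q z)"
  using assms by (intro continuous_intros) auto

text \<open>The residue theorem is applied to each circle. A zero of \<open>q\<close> is not in
  \<open>X\<close>, so if it lies in the outer disk it lies in exactly one hole and its two
  contributions cancel. The point \<open>x\<close> lies in no hole, so only its residue survives,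
  which is the Taylor coefficient.\<close>

lemma taylor_functional_rational:
  assumes q: "\<And>z. z \<in> X \<Longrightarrow> poly q z \<noteq> 0"
  shows "taylor_functional j (\<lambda>z. poly p z / poly q z) =
    (deriv ^^ j) (\<lambda>z. poly p z / poly q z) x / fact j"
proof -
  define F where "F z = poly p z / poly q z" for z
  define G where "G z = F z / (z - x) ^ Suc j" for z
  define Z where "Z = {z. poly q z = 0}"
  have q0: "q \<noteq> 0" using q[OF x_in_cheese] by auto
  have fin: "finite Z" unfolding Z_def using q0 by (rule poly_roots_finite)
  have xZ: "x \<notin> Z" using q[OF x_in_cheese] by (simp add: Z_def)
  have holF: "F holomorphic_on - Z"
    unfolding F_def[abs_def] by (intro holomorphic_intros) (auto simp: Z_def)
  have holG: "G holomorphic_on UNIV - insert x Z"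
    unfolding G_def[abs_def] using holomorphic_on_subset[OF holF, of "UNIV - insert x Z"]
    by (intro holomorphic_on_divide holomorphic_intros) auto
  have off: "sphere (ctr n) (rad n) \<inter> insert x Z = {}" if "0 < rad n" for n
    using circle_subset[OF that] circle_gap[of x n] gap_pos[OF that] q by (auto simp: Z_def)
  have ci: "circle_integral n j F = (\<Sum>z\<in>insert x Z.
      if z \<in> ball (ctr n) (rad n) then 2 * pi * \<i> * residue G z else 0)" for n
  proof (cases "0 < rad n")
    case True
    let ?c = "circlepath (ctr n) (rad n)"
    have "contour_integral ?c G = 2 * pi * \<i> * (\<Sum>z\<in>insert x Z. winding_number ?c z * residue G z)"
      by (rule Residue_theorem) (use fin holG off[OF True] True in auto)
    also have "\<dots> = (\<Sum>z\<in>insert x Z. 2 * pi * \<i> * (winding_number ?c z * residue G z))"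
      by (rule sum_distrib_left)
    also have "\<dots> = (\<Sum>z\<in>insert x Z.
        if z \<in> ball (ctr n) (rad n) then 2 * pi * \<i> * residue G z else 0)"
    proof (rule sum.cong[OF refl])
      fix z assume z: "z \<in> insert x Z"
      show "2 * pi * \<i> * (winding_number ?c z * residue G z) =
          (if z \<in> ball (ctr n) (rad n) then 2 * pi * \<i> * residue G z else 0)"
      proof (cases "z \<in> ball (ctr n) (rad n)")
        case True
        then show ?thesis by (simp add: winding_number_circlepath dist_norm norm_minus_commute)
      next
        case False
        hence "z \<notin> cball (ctr n) (rad n)" using off[OF True] z by force
        hence "winding_number ?c z = 0"
          by (intro winding_number_zero_outside[of _ "cball (ctr n) (rad n)"]) (use True in auto)
        then show ?thesis using False by simp
      qed
    qed
    finally show ?thesis using True by (simp add: circle_integral_def G_def[abs_def])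
  next
    case False
    hence "z \<notin> ball (ctr n) (rad n)" for z
      using order.trans[OF _ zero_le_dist, of "rad n" "ctr n" z] by simp
    then show ?thesis using False by (simp add: circle_integral_def del: mem_ball)
  qed
  \<comment> \<open>\<open>h z\<close> collects what the pole \<open>z\<close> contributes to all
    holes together; by disjointness the series has at most one nonzero term.\<close>
  define h where "h z = (if \<exists>n. z \<in> ball (ctr (Suc n)) (rad (Suc n)) then 2 * pi * \<i> * residue G z else 0)" for z
  have "(\<lambda>n. if z \<in> ball (ctr (Suc n)) (rad (Suc n)) then 2 * pi * \<i> * residue G z else 0) sums h z" for z
  proof (cases "\<exists>n. z \<in> ball (ctr (Suc n)) (rad (Suc n))")
    case True
    then obtain n where n: "z \<in> ball (ctr (Suc n)) (rad (Suc n))" by blast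
    hence r: "0 < rad (Suc n)" by (auto dest: le_less_trans[OF zero_le_dist])
    have "z \<in> ball (ctr (Suc m)) (rad (Suc m)) \<longleftrightarrow> m = n" for m
    proof -
      have "z \<in> cball (ctr (Suc n)) (rad (Suc n))"
        using n ball_subset_cball[of "ctr (Suc n)" "rad (Suc n)"] by (rule rev_subsetD)
      thus ?thesis using inner_disks_disjoint[of "Suc n" "Suc m" z] n r by (cases "m = n") simp_all
    qed
    then show ?thesis using True sums_single[of n "\<lambda>_. 2 * pi * \<i> * residue G z"] by (simp add: h_def)
  next
    case False
    then show ?thesis by (auto simp: h_def)
  qed
  hence "(\<lambda>n. circle_integral (Suc n) j F) sums (\<Sum>z\<in>insert x Z. h z)"
    unfolding ci by (rule sums_sum)
  hence sm: "(\<Sum>n. circle_integral (Suc n) j F) = (\<Sum>z\<in>insert x Z. h z)" by (rule sums_unique[symmetric])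
  have hx: "h x = 0"
    using x_in_cheese by (auto simp: h_def cheese_set_def)
  \<comment> \<open>For a zero of \<open>q\<close>, lying in some hole is equivalent to lying in the
    open outer disk: it is missing from \<open>X\<close>, and every hole is inside the outer
    disk.\<close>
  have hZ: "h z = (if z \<in> ball (ctr 0) (rad 0) then 2 * pi * \<i> * residue G z else 0)" if "z \<in> Z" for z
  proof -
    have "z \<notin> X" using that q by (auto simp: Z_def)
    have 1: "\<exists>n. z \<in> ball (ctr (Suc n)) (rad (Suc n))" if "z \<in> cball (ctr 0) (rad 0)"
    proof -
      have "z \<in> (\<Union>n\<in>{1..}. ball (ctr n) (rad n))"
        using that \<open>z \<notin> X\<close> unfolding cheese_set_def by (simp only: Diff_iff simp_thms)
      then obtain n where "n \<in> {1..}" and n: "z \<in> ball (ctr n) (rad n)"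
        by (rule UN_E)
      hence "z \<in> ball (ctr (Suc (n - 1))) (rad (Suc (n - 1)))" by simp
      thus ?thesis by (rule exI)
    qed
    have 2: "z \<in> ball (ctr 0) (rad 0)" if b: "z \<in> ball (ctr (Suc n)) (rad (Suc n))" for n
    proof -
      have "0 < rad (Suc n)" using b by (auto dest: le_less_trans[OF zero_le_dist])
      hence "cball (ctr (Suc n)) (rad (Suc n)) \<subseteq> ball (ctr 0) (rad 0)"
        by (rule inner_disk_subset) simp
      moreover have "z \<in> cball (ctr (Suc n)) (rad (Suc n))"
        using b ball_subset_cball[of "ctr (Suc n)" "rad (Suc n)"] by (rule rev_subsetD)
      ultimately show ?thesis by (rule subsetD)
    qed
    show ?thesis
    proof (cases "z \<in> ball (ctr 0) (rad 0)")
      case True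
      hence "z \<in> cball (ctr 0) (rad 0)"
        using ball_subset_cball[of "ctr 0" "rad 0"] by (rule rev_subsetD)
      hence "\<exists>n. z \<in> ball (ctr (Suc n)) (rad (Suc n))" by (rule 1)
      then show ?thesis using True by (simp add: h_def del: mem_ball)
    next
      case False
      hence "\<not> (\<exists>n. z \<in> ball (ctr (Suc n)) (rad (Suc n)))" using 2 by blast
      then show ?thesis using False by (simp add: h_def del: mem_ball)
    qed
  qed
  have "circle_integral 0 j F - (\<Sum>n. circle_integral (Suc n) j F) = 2 * pi * \<i> * residue G x"
  proof -
    have "(\<Sum>z\<in>insert x Z. h z) = (\<Sum>z\<in>Z. h z)" using fin xZ hx by simp
    also have "\<dots> = (\<Sum>z\<in>Z. if z \<in> ball (ctr 0) (rad 0) then 2 * pi * \<i> * residue G z else 0)"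
      by (rule sum.cong[OF refl hZ])
    finally show ?thesis
      unfolding sm ci[of 0] sum.insert[OF fin xZ] using x_inside by (simp del: mem_ball)
  qed
  also have "residue G x = (deriv ^^ j) F x / fact j"
    unfolding G_def[abs_def]
    using fin xZ by (intro residue_holomorphic_over_power[OF _ _ holF] open_Compl finite_imp_closed) auto
  finally have "taylor_functional j F = (deriv ^^ j) F x / fact j"
    by (simp add: taylor_functional_def)
  thus ?thesis by (simp only: F_def[abs_def])
qed

text \<open>This is the Leibniz rule for higher derivatives; dividing by \<open>fact j\<close> turns
  the binomial coefficients into a plain convolution.\<close>

lemma taylor_functional_rational_mult:
  assumes q: "\<And>z. z \<in> X \<Longrightarrow> poly q z \<noteq> 0" and q': "\<And>z. z \<in> X \<Longrightarrow> poly q' z \<noteq> 0"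
  shows "taylor_functional j (\<lambda>z. (poly p z / poly q z) * (poly p' z / poly q' z)) =
    (\<Sum>k=0..j. taylor_functional k (\<lambda>z. poly p z / poly q z) *
               taylor_functional (j - k) (\<lambda>z. poly p' z / poly q' z))"
proof -
  let ?F = "\<lambda>z. poly p z / poly q z" and ?G = "\<lambda>z. poly p' z / poly q' z"
  let ?Z = "{z. poly q z = 0} \<union> {z. poly q' z = 0}"
  have "q \<noteq> 0" "q' \<noteq> 0" using q[OF x_in_cheese] q'[OF x_in_cheese] by auto
  hence "finite {z. poly q z = 0}" "finite {z. poly q' z = 0}" by (simp_all add: poly_roots_finite)
  hence "finite ?Z" by simp
  hence op: "open (- ?Z)" by (intro open_Compl finite_imp_closed)
  have x: "x \<in> - ?Z" using q[OF x_in_cheese] q'[OF x_in_cheese] by auto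
  have hol: "?F holomorphic_on - ?Z" "?G holomorphic_on - ?Z"
    by (intro holomorphic_on_divide poly_holomorphic_on holomorphic_on_ident; auto)+
  have "taylor_functional j (\<lambda>z. ?F z * ?G z) = taylor_functional j (\<lambda>z. poly (p * p') z / poly (q * q') z)"
    by simp
  also have "\<dots> = (deriv ^^ j) (\<lambda>z. poly (p * p') z / poly (q * q') z) x / fact j"
    by (rule taylor_functional_rational) (use q q' in auto)
  also have "(\<lambda>z. poly (p * p') z / poly (q * q') z) = (\<lambda>z. ?F z * ?G z)" by simp
  also have "(deriv ^^ j) (\<lambda>z. ?F z * ?G z) x / fact j =
      (\<Sum>k=0..j. of_nat (j choose k) * (deriv ^^ k) ?F x * (deriv ^^ (j - k)) ?G x) / fact j"
    by (subst higher_deriv_mult[OF hol op x]) simp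
  also have "\<dots> = (\<Sum>k=0..j. ((deriv ^^ k) ?F x / fact k) * ((deriv ^^ (j - k)) ?G x / fact (j - k)))"
    unfolding sum_divide_distrib
  proof (rule sum.cong[OF refl])
    fix k assume "k \<in> {0..j}"
    hence "(of_nat (j choose k) :: complex) = fact j / (fact k * fact (j - k))"
      by (simp add: binomial_fact)
    thus "of_nat (j choose k) * (deriv ^^ k) ?F x * (deriv ^^ (j - k)) ?G x / fact j =
        ((deriv ^^ k) ?F x / fact k) * ((deriv ^^ (j - k)) ?G x / fact (j - k))"
      by simp
  qed
  finally show ?thesis using taylor_functional_rational[OF q] taylor_functional_rational[OF q'] by simp
qed

section \<open>Passage from rational functions to R(X)\<close>

lemma R_alg_approx:
  assumes "f \<in> R_alg X"
  shows "\<exists>p q. (\<forall>n. \<forall>z\<in>X. poly (q n) z \<noteq> 0) \<and>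
    uniform_limit X (\<lambda>n z. poly (p n) z / poly (q n) z) f sequentially"
proof -
  have "\<exists>p q. (\<forall>z\<in>X. poly q z \<noteq> 0) \<and> (\<forall>z\<in>X. cmod (f z - poly p z / poly q z) < 1 / Suc n)" for n
    using assms by (simp add: R_alg_def)
  then obtain p q where pq: "\<And>n z. z \<in> X \<Longrightarrow> poly (q n) z \<noteq> 0"
    "\<And>n z. z \<in> X \<Longrightarrow> cmod (f z - poly (p n) z / poly (q n) z) < 1 / Suc n" by metis
  show ?thesis
  proof (intro exI conjI)
    show "\<forall>n. \<forall>z\<in>X. poly (q n) z \<noteq> 0" using pq(1) by simp
    show "uniform_limit X (\<lambda>n z. poly (p n) z / poly (q n) z) f sequentially"
    proof (rule uniform_limitI)
      fix e :: real assume "0 < e"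
      then obtain N where N: "1 / Suc N < e" by (rule nat_approx_posE)
      have "dist (poly (p n) z / poly (q n) z) (f z) < e" if "n \<ge> N" "z \<in> X" for n z
      proof -
        have "1 / real (Suc n) \<le> 1 / Suc N" using that(1) by (simp add: frac_le)
        thus ?thesis using pq(2)[OF that(2), of n] N by (simp add: dist_norm norm_minus_commute)
      qed
      thus "\<forall>\<^sub>F n in sequentially. \<forall>z\<in>X. dist (poly (p n) z / poly (q n) z) (f z) < e"
        by (auto simp: eventually_sequentially)
    qed
  qed
qed

lemma taylor_functional_0:
  assumes "f \<in> R_alg X"
  shows "taylor_functional 0 f = f x"
proof -
  obtain p q where "\<forall>n. \<forall>z\<in>X. poly (q n) z \<noteq> 0"
    and lim: "uniform_limit X (\<lambda>n z. poly (p n) z / poly (q n) z) f sequentially"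
    using R_alg_approx[OF assms] by auto
  hence nz: "\<And>n z. z \<in> X \<Longrightarrow> poly (q n) z \<noteq> 0" by simp
  have f: "continuous_on X f" using assms by (simp add: R_alg_def)
  have "(\<lambda>n. taylor_functional 0 (\<lambda>z. poly (p n) z / poly (q n) z)) \<longlonglongrightarrow> taylor_functional 0 f"
    by (rule taylor_functional_tendsto[OF continuous_on_rational[OF nz] f lim])
  moreover have "(\<lambda>n. taylor_functional 0 (\<lambda>z. poly (p n) z / poly (q n) z)) \<longlonglongrightarrow> f x"
    using tendsto_uniform_limitI[OF lim x_in_cheese]
    by (simp add: taylor_functional_rational[OF nz])
  ultimately show ?thesis by (rule LIMSEQ_unique)
qed

text \<open>Both sides are continuous under uniform convergence, so the identity passes from
  rational approximants to the limit. Products converge uniformly because \<open>f\<close> and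
  \<open>g\<close> are bounded on the compact set \<open>X\<close>.\<close>

lemma taylor_functional_mult:
  assumes f: "f \<in> R_alg X" and g: "g \<in> R_alg X"
  shows "taylor_functional j (\<lambda>z. f z * g z) =
    (\<Sum>k=0..j. taylor_functional k f * taylor_functional (j - k) g)"
proof -
  obtain p q where "\<forall>n. \<forall>z\<in>X. poly (q n) z \<noteq> 0"
    and lim: "uniform_limit X (\<lambda>n z. poly (p n) z / poly (q n) z) f sequentially"
    using R_alg_approx[OF f] by auto
  hence nz: "\<And>n z. z \<in> X \<Longrightarrow> poly (q n) z \<noteq> 0" by simp
  obtain p' q' where "\<forall>n. \<forall>z\<in>X. poly (q' n) z \<noteq> 0"
    and lim': "uniform_limit X (\<lambda>n z. poly (p' n) z / poly (q' n) z) g sequentially"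
    using R_alg_approx[OF g] by auto
  hence nz': "\<And>n z. z \<in> X \<Longrightarrow> poly (q' n) z \<noteq> 0" by simp
  let ?F = "\<lambda>n z. poly (p n) z / poly (q n) z" and ?G = "\<lambda>n z. poly (p' n) z / poly (q' n) z"
  have cf: "continuous_on X f" and cg: "continuous_on X g" using f g by (auto simp: R_alg_def)
  have cF: "continuous_on X (?F n)" and cG: "continuous_on X (?G n)" for n
    using continuous_on_rational nz nz' by blast+
  have bd: "bounded (f ` X)" "bounded (g ` X)"
    using cf cg cheese_compact compact_continuous_image compact_imp_bounded by blast+
  have "uniform_limit X (\<lambda>n z. ?F n z * ?G n z) (\<lambda>z. f z * g z) sequentially"
    by (rule uniform_lim_mult[OF lim lim' bd])
  hence "(\<lambda>n. taylor_functional j (\<lambda>z. ?F n z * ?G n z)) \<longlonglongrightarrow> taylor_functional j (\<lambda>z. f z * g z)"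
    by (rule taylor_functional_tendsto[rotated -1])
      (rule continuous_on_mult[OF cF cG], rule continuous_on_mult[OF cf cg])
  moreover have "taylor_functional j (\<lambda>z. ?F n z * ?G n z) =
      (\<Sum>k=0..j. taylor_functional k (?F n) * taylor_functional (j - k) (?G n))" for n
    by (rule taylor_functional_rational_mult[OF nz nz'])
  moreover have "(\<lambda>n. \<Sum>k=0..j. taylor_functional k (?F n) * taylor_functional (j - k) (?G n))
      \<longlonglongrightarrow> (\<Sum>k=0..j. taylor_functional k f * taylor_functional (j - k) g)"
    by (rule tendsto_sum, rule tendsto_mult)
      (rule taylor_functional_tendsto[OF cF cf lim], rule taylor_functional_tendsto[OF cG cg lim'])
  ultimately show ?thesis by (simp only:) (rule LIMSEQ_unique)
qed

lemma taylor_functional_point_derivation: "point_derivation_inf X x taylor_functional"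
proof -
  have "continuous_on X f" if "f \<in> R_alg X" for f using that by (simp add: R_alg_def)
  thus ?thesis
    unfolding point_derivation_inf_def linear_functional_R_def
    by (simp add: taylor_functional_add taylor_functional_cmult taylor_functional_0
        taylor_functional_mult x_in_cheese)
qed

lemma taylor_functional_bounded: "bounded_derivation X taylor_functional"
  unfolding bounded_derivation_def bounded_functional_R_def
proof
  fix j
  obtain C where C: "0 \<le> C" "\<And>f M. continuous_on X f \<Longrightarrow> (\<And>z. z \<in> X \<Longrightarrow> cmod (f z) \<le> M) \<Longrightarrow>
    cmod (taylor_functional j f) \<le> C * M" using taylor_functional_bound[of j] by auto
  have "cmod (taylor_functional j f) \<le> C * sup_norm_on X f" if f: "f \<in> R_alg X" for f
  proof (rule C(2))
    show cf: "continuous_on X f" using f by (simp add: R_alg_def)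
    obtain M where "\<And>z. z \<in> X \<Longrightarrow> cmod (f z) \<le> M" by (rule continuous_bounded[OF cf]) blast
    thus "cmod (f z) \<le> sup_norm_on X f" if "z \<in> X" for z
      unfolding sup_norm_on_def using that by (intro cSUP_upper bdd_aboveI2) auto
  qed
  thus "\<exists>C. \<forall>f\<in>R_alg X. cmod (taylor_functional j f) \<le> C * sup_norm_on X f" by blast
qed

lemma taylor_functional_nondegenerate: "nondegenerate_derivation X taylor_functional"
  unfolding nondegenerate_derivation_def
proof
  let ?f = "\<lambda>z. if z \<in> X then z else 0"
  have c: "continuous_on X ?f" by (rule continuous_on_eq[OF continuous_on_id]) simp
  have "\<exists>p q. (\<forall>z\<in>X. poly q z \<noteq> 0) \<and> (\<forall>z\<in>X. cmod (?f z - poly p z / poly q z) < e)" if "0 < e" for e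
    using that by (intro exI[of _ "[:0, 1:]"] exI[of _ 1]) auto
  thus "?f \<in> R_alg X"
    unfolding R_alg_def using c by auto
  \<comment> \<open>Every circle of positive radius lies in \<open>X\<close>, so cutting the
    coordinate function off outside \<open>X\<close> does not change the integrals.\<close>
  have "circle_integral n 1 ?f = circle_integral n 1 (\<lambda>z. z)" for n
  proof (cases "0 < rad n")
    case True
    thus ?thesis unfolding circle_integral_def
      using circle_subset[OF True] by (simp, intro contour_integral_cong) auto
  qed (simp add: circle_integral_def)
  hence "taylor_functional 1 ?f = taylor_functional 1 (\<lambda>z. poly [:0, 1:] z / poly 1 z)"
    by (simp add: taylor_functional_def)
  also have "\<dots> = 1" by (subst taylor_functional_rational) auto
  finally show "taylor_functional 1 ?f \<noteq> 0" by simp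
qed

end

section \<open>Functions supported in a disk\<close>

lemma R_alg_uniform_limit:
  assumes nz: "\<And>n z. z \<in> X \<Longrightarrow> poly (q n) z \<noteq> 0"
    and lim: "uniform_limit X (\<lambda>n z. poly (p n) z / poly (q n) z) f sequentially"
    and off: "\<And>z. z \<notin> X \<Longrightarrow> f z = 0"
  shows "f \<in> R_alg X"
proof -
  have "continuous_on X f"
  proof (rule uniform_limit_theorem[OF _ lim])
    show "\<forall>\<^sub>F n in sequentially. continuous_on X (\<lambda>z. poly (p n) z / poly (q n) z)"
      using nz by (intro always_eventually allI continuous_intros) auto
  qed simp
  moreover have "\<exists>p q. (\<forall>z\<in>X. poly q z \<noteq> 0) \<and> (\<forall>z\<in>X. cmod (f z - poly p z / poly q z) < e)"
    if "0 < e" for e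
  proof -
    have "\<forall>\<^sub>F n in sequentially. \<forall>z\<in>X. dist (poly (p n) z / poly (q n) z) (f z) < e"
      using uniform_limitD[OF lim that] .
    then obtain n where "\<forall>z\<in>X. dist (poly (p n) z / poly (q n) z) (f z) < e"
      by (auto simp: eventually_sequentially)
    thus ?thesis using nz
      by (intro exI[of _ "p n"] exI[of _ "q n"]) (auto simp: dist_norm norm_minus_commute)
  qed
  ultimately show ?thesis using off by (simp add: R_alg_def)
qed

text \<open>In the application \<open>u\<close> is the distance from a centre and \<open>M k\<close>
  a radius between the \<open>k\<close>-th and the next circle of poles. An increment of the partial
  products is small for one of two reasons: up to \<open>M n\<close> the new factor is near 1
  (\<open>small\<close>), and beyond it the old factors damp the new one (\<open>half\<close>,
  \<open>comp\<close>).\<close>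

lemma infinite_product_R_alg:
  fixes q :: "nat \<Rightarrow> complex poly" and u :: "complex \<Rightarrow> real"
  assumes nz: "\<And>k z. z \<in> X \<Longrightarrow> poly (q k) z \<noteq> 0"
    and small: "\<And>k z. z \<in> X \<Longrightarrow> u z \<le> M k \<Longrightarrow> cmod (1 / poly (q (Suc k)) z - 1) \<le> (1/2) ^ (k + 3)"
    and half: "\<And>k z. z \<in> X \<Longrightarrow> M k \<le> u z \<Longrightarrow> cmod (1 / poly (q k) z) \<le> 1/2"
    and comp: "\<And>k z. z \<in> X \<Longrightarrow> M k \<le> u z \<Longrightarrow>
      cmod (1 / poly (q k) z) * cmod (1 / poly (q (Suc k)) z - 1) \<le> (1/2) ^ k"
    and bound0: "\<And>z. z \<in> X \<Longrightarrow> cmod (1 / poly (q 0) z) \<le> B"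
    and M: "incseq M" "M \<longlonglongrightarrow> \<rho>"
  shows "\<exists>f\<in>R_alg X. \<forall>z\<in>X. f z = 0 \<longleftrightarrow> \<rho> \<le> u z"
proof -
  define h where "h k z = 1 / poly (q k) z" for k z
  define P where "P n z = (\<Prod>k\<le>n. h k z)" for n z
  define D where "D n z = P n z * (h (Suc n) z - 1)" for n z
  \<comment> \<open>\<open>C\<close> has to bound the first factor and to be at least 2, so that an
    outer increment \<open>(1/2) ^ n\<close> is at most half of
    \<open>C * (1/2) ^ n\<close>.\<close>
  define C where "C = max 4 B"
  have C: "4 \<le> C" "B \<le> C" by (auto simp: C_def)
  have P_Suc: "P (Suc n) z = P n z * h (Suc n) z" for n z by (simp add: P_def)
  have D_eq: "D n z = P (Suc n) z - P n z" for n z by (simp add: D_def P_Suc algebra_simps)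
  have big: "cmod (D n z) \<le> (1/2) ^ n" if z: "z \<in> X" and u: "M n \<le> u z" for n z
  proof -
    have "cmod (h k z) \<le> 1" if "k < n" for k
      using half[OF z, of k] u incseqD[OF M(1), of k n] that by (simp add: h_def)
    hence "(\<Prod>k<n. cmod (h k z)) \<le> 1" by (intro prod_le_1) auto
    moreover have "P n z = (\<Prod>k<n. h k z) * h n z"
      unfolding P_def lessThan_Suc_atMost[symmetric] by simp
    hence "cmod (D n z) = (\<Prod>k<n. cmod (h k z)) * (cmod (h n z) * cmod (h (Suc n) z - 1))"
      by (simp add: D_def norm_mult prod_norm mult.assoc)
    moreover have "cmod (h n z) * cmod (h (Suc n) z - 1) \<le> (1/2) ^ n"
      using comp[OF z u] by (simp add: h_def)
    ultimately show ?thesis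
      using mult_mono[of "\<Prod>k<n. cmod (h k z)" 1 "cmod (h n z) * cmod (h (Suc n) z - 1)" "(1/2)^n"]
      by simp
  qed
  have inside: "cmod (D n z) \<le> cmod (P n z) * (1/2) ^ (n + 3)" if z: "z \<in> X" and u: "u z \<le> M n" for n z
    unfolding D_def norm_mult using small[OF z u] by (intro mult_left_mono) (auto simp: h_def)
  \<comment> \<open>The bound leaves room for an increment of \<open>C * (1/2) ^ n / 2\<close> at
    step \<open>n\<close>; altogether these use up another \<open>C\<close>.\<close>
  have Pb: "cmod (P n z) \<le> C * (2 - (1/2) ^ n)" if z: "z \<in> X" for n z
  proof (induction n)
    case 0
    show ?case using bound0[OF z] C by (simp add: P_def h_def)
  next
    case (Suc n)
    define t :: real where "t = (1/2) ^ n"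
    have t: "0 < t" "t \<le> 1" by (auto simp: t_def power_le_one)
    have "cmod (D n z) \<le> C * t / 2"
    proof (cases "u z \<le> M n")
      case True
      have "cmod (P n z) * (1/2) ^ (n + 3) \<le> (2 * C) * (1/2) ^ (n + 3)"
      proof (rule mult_right_mono)
        have "C * (2 - t) \<le> 2 * C" using C t by (simp add: algebra_simps)
        thus "cmod (P n z) \<le> 2 * C" using Suc by (simp add: t_def)
      qed simp
      also have "\<dots> \<le> C * t / 2" using C t by (simp add: t_def power_add eval_nat_numeral)
      finally show ?thesis using inside[OF z True] by simp
    next
      case False
      have "t \<le> C * t / 2" using C t by simp
      thus ?thesis using big[OF z, of n] False unfolding t_def by linarith
    qed
    moreover have "cmod (P (Suc n) z) \<le> cmod (P n z) + cmod (D n z)"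
      using norm_triangle_ineq[of "P n z" "D n z"] by (simp add: D_eq)
    ultimately have "cmod (P (Suc n) z) \<le> C * (2 - t) + C * t / 2" using Suc by (simp add: t_def)
    thus ?case by (simp add: t_def algebra_simps)
  qed
  have Db: "cmod (D n z) \<le> C * (1/2) ^ n" if z: "z \<in> X" for n z
  proof (cases "u z \<le> M n")
    case True
    have "cmod (P n z) * (1/2) ^ (n + 3) \<le> (C * 2) * (1/2) ^ (n + 3)"
    proof (rule mult_right_mono)
      have "C * (2 - (1/2) ^ n) \<le> C * 2" using C by (intro mult_left_mono) auto
      thus "cmod (P n z) \<le> C * 2" using Pb[OF z, of n] by linarith
    qed simp
    also have "\<dots> \<le> C * (1/2) ^ n" using C by (simp add: power_add eval_nat_numeral)
    finally show ?thesis using inside[OF z True] by linarith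
  next
    case False
    have "1 * (1/2) ^ n \<le> C * (1/2::real) ^ n" using C by (intro mult_right_mono) auto
    thus ?thesis using big[OF z, of n] False by linarith
  qed
  define g where "g z = P 0 z + (\<Sum>n. D n z)" for z
  have "uniform_limit X (\<lambda>n z. \<Sum>i<n. D i z) (\<lambda>z. \<Sum>n. D n z) sequentially"
    by (rule Weierstrass_m_test[of _ _ "\<lambda>n. C * (1/2) ^ n"]) (use Db in \<open>auto intro!: summable_mult summable_geometric\<close>)
  moreover have "(\<Sum>i<n. D i z) = P n z - P 0 z" for n z
    unfolding D_eq by (rule sum_lessThan_telescope)
  ultimately have "uniform_limit X (\<lambda>n z. P n z - P 0 z) (\<lambda>z. \<Sum>n. D n z) sequentially" by simp
  from uniform_limit_add[OF this uniform_limit_const, of "P 0"]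
  have lim: "uniform_limit X P g sequentially"
    by (simp add: g_def[abs_def] add.commute eta_contract_eq)
  define f where "f z = (if z \<in> X then g z else 0)" for z
  have ptw: "(\<lambda>n. P n z) \<longlonglongrightarrow> f z" if "z \<in> X" for z
    using tendsto_uniform_limitI[OF lim that] that by (simp add: f_def)
  have "f \<in> R_alg X"
  proof (rule R_alg_uniform_limit)
    show "poly (\<Prod>k\<le>n. q k) z \<noteq> 0" if "z \<in> X" for n z
      using nz that by (simp add: poly_prod)
    have "P n z = poly 1 z / poly (\<Prod>k\<le>n. q k) z" for n z
      by (simp add: P_def h_def poly_prod prod_dividef)
    hence "P = (\<lambda>n z. poly 1 z / poly (\<Prod>k\<le>n. q k) z)" by blast
    moreover have "uniform_limit X P f sequentially"
      using lim by (rule uniform_limit_cong'[THEN iffD1, rotated -1]) (auto simp: f_def)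
    ultimately show "uniform_limit X (\<lambda>n z. poly 1 z / poly (\<Prod>k\<le>n. q k) z) f sequentially" by simp
  qed (simp add: f_def)
  moreover have "f z = 0" if z: "z \<in> X" and u: "\<rho> \<le> u z" for z
  proof -
    have "cmod (h k z) \<le> 1/2" for k
      using half[OF z, of k] incseq_le[OF M, of k] u by (simp add: h_def)
    hence "cmod (P n z) \<le> (1/2) ^ Suc n" for n
      using prod_mono[of "{..n}" "\<lambda>k. cmod (h k z)" "\<lambda>_. 1/2"] by (simp add: P_def prod_norm)
    moreover have "(\<lambda>n. (1/2::real) ^ Suc n) \<longlonglongrightarrow> 0"
      by (intro LIMSEQ_Suc LIMSEQ_power_zero) simp
    ultimately have "(\<lambda>n. P n z) \<longlonglongrightarrow> 0"
      by (intro Lim_null_comparison[of "\<lambda>n. P n z" "\<lambda>n. (1/2) ^ Suc n"] always_eventually) auto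
    thus ?thesis using ptw[OF z] LIMSEQ_unique by blast
  qed
  moreover have "f z \<noteq> 0" if z: "z \<in> X" and u: "u z < \<rho>" for z
  proof -
    obtain k0 where "u z < M k0"
      using order_tendstoD(1)[OF M(2) u] by (auto simp: eventually_sequentially)
    hence k0: "u z \<le> M (k0 + m)" for m using incseqD[OF M(1), of k0 "k0 + m"] by simp
    \<comment> \<open>From \<open>k0\<close> on, the step from \<open>m\<close> costs at most a
      factor \<open>1 - t / 8\<close> with \<open>t = (1/2) ^ m\<close>. The lower bound decreases
      to 1/2 slowly enough for the induction to absorb these factors, so the limit stays away from
      zero.\<close>
    have lower: "cmod (P k0 z) * (1/2 + (1/2) ^ Suc m) \<le> cmod (P (k0 + m) z)" for m
    proof (induction m)
      case (Suc m)
      define t :: real where "t = (1/2) ^ m"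
      have t: "0 < t" "t \<le> 1" by (auto simp: t_def power_le_one)
      have "(1/2::real) ^ (k0 + m + 3) \<le> (1/2) ^ (m + 3)" by (rule power_decreasing) auto
      hence t8: "(1/2::real) ^ (k0 + m + 3) \<le> t / 8" by (simp add: t_def power_add eval_nat_numeral)
      have "cmod (D (k0 + m) z) \<le> cmod (P (k0 + m) z) * (t / 8)"
        using inside[OF z k0, of m] mult_left_mono[OF t8, of "cmod (P (k0 + m) z)"] by simp
      moreover have "cmod (P (k0 + m) z) \<le> cmod (P (k0 + Suc m) z) + cmod (D (k0 + m) z)"
        using norm_triangle_ineq4[of "P (k0 + Suc m) z" "D (k0 + m) z"] by (simp add: D_eq)
      ultimately have "cmod (P (k0 + m) z) * (1 - t / 8) \<le> cmod (P (k0 + Suc m) z)"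
        by (simp add: algebra_simps)
      moreover have "cmod (P k0 z) * (1/2 + t / 2) * (1 - t / 8) \<le> cmod (P (k0 + m) z) * (1 - t / 8)"
        using Suc t by (intro mult_right_mono) (auto simp: t_def)
      moreover have "1/2 + t / 4 \<le> (1/2 + t / 2) * (1 - t / 8)"
      proof -
        have "t * t \<le> t" using t mult_left_le by auto
        thus ?thesis using t by (simp add: algebra_simps)
      qed
      hence "cmod (P k0 z) * (1/2 + t / 4) \<le> cmod (P k0 z) * (1/2 + t / 2) * (1 - t / 8)"
        by (simp only: mult.assoc) (rule mult_left_mono, auto)
      ultimately show ?case by (simp add: t_def)
    qed simp
    have "cmod (P k0 z) / 2 \<le> cmod (P n z)" if "n \<ge> k0" for n
    proof -
      have "cmod (P k0 z) * (1/2) \<le> cmod (P k0 z) * (1/2 + (1/2) ^ Suc (n - k0))"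
        by (intro mult_left_mono) auto
      thus ?thesis using lower[of "n - k0"] that by simp
    qed
    hence "cmod (P k0 z) / 2 \<le> cmod (f z)"
      by (intro LIMSEQ_le_const[OF tendsto_norm[OF ptw[OF z]]]) blast
    moreover have "P k0 z \<noteq> 0" using nz[OF z] by (simp add: P_def h_def)
    ultimately show ?thesis by auto
  qed
  ultimately show ?thesis by (metis not_le)
qed

text \<open>Here \<open>t k\<close> bounds the \<open>k\<close>-th denominator from below on
  \<open>X\<close>, from which the neighbourhoods of its zeros are removed. \<open>outer\<close>
  makes the \<open>k\<close>-th factor small against \<open>1 / t (Suc k)\<close>, the worst size of
  the next one; \<open>inner\<close> makes the next factor almost 1 up to radius
  \<open>M k\<close>.\<close>

lemma disk_function:
  fixes c :: complex and N :: "nat \<Rightarrow> nat" and R M t :: "nat \<Rightarrow> real"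
  assumes N: "\<And>k. 0 < N k" and R: "\<And>k. 0 < R k" "\<And>k. R k < M k" "\<And>k. M k < R (Suc k)"
    and lim: "M \<longlonglongrightarrow> \<rho>"
    and t: "\<And>k. 0 < t k" "\<And>k. t k \<le> 1"
    and X: "\<And>k z. z \<in> X \<Longrightarrow> t k \<le> cmod (1 - ((z - c) / R k) ^ N k)"
    and outer: "\<And>k. (R k / M k) ^ N k \<le> (1/2) ^ (k + 2) * t (Suc k)"
    and inner: "\<And>k. (M k / R (Suc k)) ^ N (Suc k) \<le> (1/2) ^ (k + 4)"
  shows "\<exists>f\<in>R_alg X. \<forall>z\<in>X. f z = 0 \<longleftrightarrow> z \<notin> ball c \<rho>"
proof -
  define q where "q k = 1 - [:- c / R k, 1 / R k:] ^ N k" for k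
  have q: "poly (q k) z = 1 - ((z - c) / R k) ^ N k" for k z
    by (simp add: q_def diff_divide_distrib)
  have Mpos: "0 < M k" for k using R(1,2)[of k] by simp
  have tq: "t k \<le> cmod (poly (q k) z)" if "z \<in> X" for k z using X[OF that] by (simp add: q)
  have ub: "cmod (1 / poly (q k) z) \<le> 1 / t k" if "z \<in> X" for k z
    using tq[OF that, of k] t[of k] by (simp add: norm_divide frac_le)
  have "\<exists>f\<in>R_alg X. \<forall>z\<in>X. f z = 0 \<longleftrightarrow> \<rho> \<le> cmod (z - c)"
  proof (rule infinite_product_R_alg)
    show "poly (q k) z \<noteq> 0" if "z \<in> X" for k z using tq[OF that, of k] t(1)[of k] by auto
    show "cmod (1 / poly (q (Suc k)) z - 1) \<le> (1/2) ^ (k + 3)" if z: "z \<in> X" and u: "cmod (z - c) \<le> M k" for k z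
    proof -
      define v where "v = ((z - c) / R (Suc k)) ^ N (Suc k)"
      have "cmod v \<le> (M k / R (Suc k)) ^ N (Suc k)"
        unfolding v_def norm_power norm_divide
        using u R(1)[of "Suc k"] by (intro power_mono) (auto simp: divide_right_mono)
      hence v: "cmod v \<le> (1/2) ^ (k + 4)" using inner[of k] by simp
      moreover have "(1/2::real) ^ (k + 4) \<le> (1/2) ^ 1" by (rule power_decreasing) auto
      ultimately have v2: "cmod v \<le> 1/2" by simp
      have l: "1/2 \<le> cmod (1 - v)" using norm_triangle_ineq2[of 1 v] v2 by simp
      hence "1 - v \<noteq> 0" by auto
      hence "1 / (1 - v) - 1 = v / (1 - v)" by (simp add: field_simps)
      hence "cmod (1 / (1 - v) - 1) = cmod v / cmod (1 - v)" by (simp add: norm_divide)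
      also have "\<dots> \<le> cmod v / (1/2)" using l by (intro divide_left_mono) auto
      also have "\<dots> \<le> (1/2) ^ (k + 3)" using v by (simp add: power_add eval_nat_numeral)
      finally show ?thesis by (simp add: q v_def)
    qed
    \<comment> \<open>Beyond \<open>M k\<close> the power \<open>v\<close> has modulus at least
      \<open>1 / b\<close> with \<open>b \<le> 1/4\<close>, so \<open>1 - v\<close> has modulus at
      least \<open>1 / (2 * b)\<close>.\<close>
    have b: "cmod (1 / poly (q k) z) \<le> 2 * ((1/2) ^ (k + 2) * t (Suc k))" if u: "M k \<le> cmod (z - c)" for k z
    proof -
      define v where "v = ((z - c) / R k) ^ N k"
      define b where "b = (R k / M k) ^ N k"
      have b0: "0 < b" using R(1)[of k] Mpos[of k] by (simp add: b_def)
      have "(1/2) ^ (k + 2) * t (Suc k) \<le> (1/2) ^ 2 * 1"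
        using t[of "Suc k"] by (intro mult_mono power_decreasing) (auto simp: less_imp_le)
      hence b4: "b \<le> 1/4" using outer[of k] by (simp add: b_def power2_eq_square)
      have "1 / b = (M k / R k) ^ N k" by (simp add: b_def power_divide)
      also have "\<dots> \<le> cmod v"
        unfolding v_def norm_power norm_divide
        using u R(1)[of k] Mpos[of k] by (intro power_mono) (auto simp: divide_right_mono)
      finally have v: "1 / b \<le> cmod v" .
      have "1 / (2 * b) \<le> 1 / b - 1" using b0 b4 by (simp add: field_simps)
      also have "\<dots> \<le> cmod (1 - v)" using v norm_triangle_ineq2[of v 1] by (simp add: norm_minus_commute)
      finally have "1 / cmod (1 - v) \<le> 1 / (1 / (2 * b))"
        using b0 by (intro divide_left_mono mult_pos_pos) (auto intro: less_le_trans[of _ "1 / (2 * b)"])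
      hence "cmod (1 / (1 - v)) \<le> 2 * b" by (simp add: norm_divide)
      hence "cmod (1 / (1 - v)) \<le> 2 * ((1/2) ^ (k + 2) * t (Suc k))"
        using outer[of k] unfolding b_def by linarith
      thus ?thesis by (simp only: q v_def)
    qed
    show "cmod (1 / poly (q k) z) \<le> 1/2" if "z \<in> X" and u: "M k \<le> cmod (z - c)" for k z
    proof -
      have "(1/2) ^ (k + 2) * t (Suc k) \<le> (1/2) ^ 2 * 1"
        using t[of "Suc k"] by (intro mult_mono power_decreasing) (auto simp: less_imp_le)
      moreover have "(1/2)\<^sup>2 * 1 = (1/4::real)" by (simp add: power2_eq_square)
      ultimately show ?thesis using b[OF u] by linarith
    qed
    show "cmod (1 / poly (q k) z) * cmod (1 / poly (q (Suc k)) z - 1) \<le> (1/2) ^ k"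
      if z: "z \<in> X" and u: "M k \<le> cmod (z - c)" for k z
    proof -
      \<comment> \<open>The crude bound \<open>2 / t (Suc k)\<close> for the next factor minus 1 is
        enough, since the estimate for the \<open>k\<close>-th factor contains
        \<open>t (Suc k)\<close> and cancels it.\<close>
      have "1 \<le> 1 / t (Suc k)" using t[of "Suc k"] by simp
      hence "cmod (1 / poly (q (Suc k)) z - 1) \<le> 2 / t (Suc k)"
        using norm_triangle_ineq4[of "1 / poly (q (Suc k)) z" 1] ub[OF z, of "Suc k"] by simp
      hence "cmod (1 / poly (q k) z) * cmod (1 / poly (q (Suc k)) z - 1)
          \<le> (2 * ((1/2) ^ (k + 2) * t (Suc k))) * (2 / t (Suc k))"
        using b[OF u] t[of "Suc k"] by (intro mult_mono) auto
      also have "\<dots> = (1/2) ^ k" using t(1)[of "Suc k"] by (simp add: power_add eval_nat_numeral)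
      finally show ?thesis .
    qed
    show "incseq M" using R(2,3) by (intro incseq_SucI) (meson less_imp_le less_trans)
  qed (use ub lim in auto)
  thus ?thesis by (simp add: dist_norm norm_minus_commute not_less)
qed

section \<open>Choosing disjoint disks\<close>

lemma cball_inside_or_disjoint:
  fixes a b :: complex
  assumes "s < \<bar>r - dist a b\<bar>"
  shows "cball b s \<subseteq> ball a r \<or> cball a r \<inter> cball b s = {}"
proof (cases "dist a b < r")
  case True
  have "cball b s \<subseteq> ball a r"
  proof
    fix z assume "z \<in> cball b s"
    thus "z \<in> ball a r" using assms True dist_triangle[of a z b] by simp
  qed
  thus ?thesis ..
next
  case False
  have "cball a r \<inter> cball b s = {}"
  proof (rule ccontr)
    assume "cball a r \<inter> cball b s \<noteq> {}"
    then obtain z where "z \<in> cball a r" "z \<in> cball b s" by blast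
    thus False using assms False dist_triangle[of a b z] by (simp add: dist_commute)
  qed
  thus ?thesis ..
qed

text \<open>The forbidden radii form intervals of half-length \<open>2 * l j\<close> about the
  distances \<open>dist b (p j i)\<close>, of total length below \<open>L\<close>. The factor 2
  anticipates that the later disks may have radii up to \<open>2 * l j\<close>.\<close>

lemma generic_radius:
  fixes p :: "nat \<Rightarrow> nat \<Rightarrow> complex" and N :: "nat \<Rightarrow> nat" and l :: "nat \<Rightarrow> real"
  assumes l: "\<And>j. 0 < l j" and sm: "summable (\<lambda>j. real (N j) * l j)"
    and L: "0 < L" "4 * (\<Sum>j. real (N (j + J)) * l (j + J)) < L"
  shows "\<exists>r. a \<le> r \<and> r \<le> a + L \<and> (\<forall>j\<ge>J. \<forall>i<N j. 2 * l j < \<bar>r - dist b (p j i)\<bar>)"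
proof -
  \<comment> \<open>Padding by zero discards both the groups before \<open>J\<close> and the pairs
    that encode no disk.\<close>
  define g where "g z = (if J \<le> fst z \<and> snd z < N (fst z) then 2 * l (fst z) else 0)" for z :: "nat \<times> nat"
  define u where "u j = (if J \<le> j then 2 * l j else 0)" for j
  have g0: "0 \<le> g (j, i)" "N j \<le> i \<Longrightarrow> g (j, i) = 0" "i < N j \<Longrightarrow> g (j, i) \<le> u j" for j i
    using l[of j] by (auto simp: g_def u_def)
  have u_shift: "real (N (j + J)) * u (j + J) = 2 * (real (N (j + J)) * l (j + J))" for j
    by (simp add: u_def)
  have smJ: "summable (\<lambda>j. real (N (j + J)) * l (j + J))"
    using sm by (rule summable_ignore_initial_segment)
  have su: "summable (\<lambda>j. real (N j) * u j)"
    by (subst summable_iff_shift[of _ J, symmetric], unfold u_shift, rule summable_mult[OF smJ])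
  have "(\<Sum>j. real (N j) * u j) = (\<Sum>j. real (N (j + J)) * u (j + J)) + (\<Sum>j<J. real (N j) * u j)"
    by (rule suminf_split_initial_segment[OF su])
  also have "(\<Sum>j<J. real (N j) * u j) = 0" by (simp add: u_def)
  also have "(\<Sum>j. real (N (j + J)) * u (j + J)) = 2 * (\<Sum>j. real (N (j + J)) * l (j + J))"
    unfolding u_shift by (rule suminf_mult[OF smJ])
  finally have "2 * (\<Sum>j. real (N j) * u j) < L" using L(2) by simp
  moreover have "summable (\<lambda>n. g (prod_decode n))" "(\<Sum>n. g (prod_decode n)) \<le> (\<Sum>j. real (N j) * u j)"
    using summable_prod_decode[of g N u, OF g0 su] by auto
  ultimately have sg: "summable (\<lambda>n. g (prod_decode n))" "2 * (\<Sum>n. g (prod_decode n)) < L" by auto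
  have gn: "0 \<le> g (prod_decode n)" for n using g0(1)[of "fst (prod_decode n)" "snd (prod_decode n)"] by simp
  obtain r where r: "a \<le> r" "r \<le> a + L"
    "\<And>n. g (prod_decode n) < \<bar>r - dist b (case_prod p (prod_decode n))\<bar> \<or> g (prod_decode n) = 0"
    using interval_not_covered[OF L(1) gn sg, of a "\<lambda>n. dist b (case_prod p (prod_decode n))"] by blast
  have "2 * l j < \<bar>r - dist b (p j i)\<bar>" if "J \<le> j" "i < N j" for j i
    using r(3)[of "prod_encode (j, i)"] that l[of j] by (simp add: g_def)
  thus ?thesis using r(1,2) by blast
qed

text \<open>The radius of each disk is chosen so that its bounding circle misses every disk of a later
  group; a later disk is therefore either swallowed, and can be dropped, or has disjoint closure.\<close>

lemma classical_cheese_selection: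
  fixes p :: "nat \<Rightarrow> nat \<Rightarrow> complex" and N :: "nat \<Rightarrow> nat" and l :: "nat \<Rightarrow> real"
  assumes l: "\<And>j. 0 < l j" and sm: "summable (\<lambda>j. real (N j) * l j)"
    and tail: "\<And>j. 4 * (\<Sum>i. real (N (i + Suc j)) * l (i + Suc j)) < l j"
    and total: "4 * (\<Sum>j. real (N j) * l j) < 1"
    and sep: "\<And>j i i'. i < N j \<Longrightarrow> i' < N j \<Longrightarrow> i \<noteq> i' \<Longrightarrow> 4 * l j < dist (p j i) (p j i')"
  shows "\<exists>B. classical_cheese B \<and> fst (B 0) = 0 \<and>
    (\<forall>j. \<forall>i<N j. cheese_set B \<inter> ball (p j i) (l j) = {}) \<and>
    (\<forall>j i. B (Suc (prod_encode (j, i))) = (0, 0) \<or>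
       i < N j \<and> fst (B (Suc (prod_encode (j, i)))) = p j i \<and>
       0 < snd (B (Suc (prod_encode (j, i)))) \<and> snd (B (Suc (prod_encode (j, i)))) \<le> 2 * l j)"
proof -
  \<comment> \<open>The admissible radii between \<open>l j\<close> and \<open>2 * l j\<close> form
    an interval of length \<open>l j\<close>, which by \<open>tail\<close> is longer than all
    intervals forbidden by later groups.\<close>
  have "\<exists>r. l j \<le> r \<and> r \<le> l j + l j \<and> (\<forall>j'\<ge>Suc j. \<forall>i'<N j'. 2 * l j' < \<bar>r - dist (p j i) (p j' i')\<bar>)" for j i
    by (rule generic_radius[OF l sm l tail])
  then obtain r where r: "\<And>j i. l j \<le> r j i" "\<And>j i. r j i \<le> l j + l j"
    "\<And>j i j' i'. j < j' \<Longrightarrow> i' < N j' \<Longrightarrow> 2 * l j' < \<bar>r j i - dist (p j i) (p j' i')\<bar>"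
    unfolding Suc_le_eq by metis
  have r2: "r j i \<le> 2 * l j" for j i using r(2)[of j i] by simp
  have rpos: "0 < r j i" for j i using r(1)[of j i] l[of j] by linarith
  \<comment> \<open>The outer circle, of radius between 1 and 2, is chosen in the same way and
    misses the disks of all groups.\<close>
  have "\<exists>s. 1 \<le> s \<and> s \<le> 1 + 1 \<and> (\<forall>j\<ge>0. \<forall>i<N j. 2 * l j < \<bar>s - dist 0 (p j i)\<bar>)"
    by (rule generic_radius[OF l sm]) (use total in simp_all)
  then obtain s where s: "1 \<le> s" "\<And>j i. i < N j \<Longrightarrow> 2 * l j < \<bar>s - dist 0 (p j i)\<bar>" by auto
  \<comment> \<open>The comparison is with all disks of earlier groups, kept or not; that a
    swallowed disk is still removed from the cheese is shown in \<open>cover\<close>.\<close>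
  define keep where "keep j i \<longleftrightarrow> i < N j \<and> cball (p j i) (r j i) \<subseteq> ball 0 s \<and>
    (\<forall>j'<j. \<forall>i'<N j'. \<not> cball (p j i) (r j i) \<subseteq> ball (p j' i') (r j' i'))" for j i
  \<comment> \<open>A dropped disk becomes \<open>(0, 0)\<close>: its open ball is empty, and its
    index is not in \<open>cheese_index\<close>.\<close>
  define D where "D z = (if case_prod keep z then (case_prod p z, case_prod r z) else (0, 0))" for z
  define B where "B n = (case n of 0 \<Rightarrow> (0, s) | Suc m \<Rightarrow> D (prod_decode m))" for n
  have B0: "B 0 = (0, s)" by (simp add: B_def)
  have BS: "B (Suc n) = D (prod_decode n)" for n by (simp add: B_def)
  have DE: "D (j, i) = (if keep j i then (p j i, r j i) else (0, 0))" for j i by (simp add: D_def)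
  have idx: "\<exists>j i. k = Suc (prod_encode (j, i)) \<and> keep j i" if "k \<in> cheese_index B" for k
  proof -
    have "k \<noteq> 0" using that by (simp add: cheese_index_def)
    then obtain m where m: "k = Suc m" using not0_implies_Suc by blast
    obtain j i where ji: "prod_decode m = (j, i)" by fastforce
    have "keep j i" using that unfolding m cheese_index_def by (simp add: BS ji DE split: if_splits)
    moreover have "m = prod_encode (j, i)" using ji by (metis prod_decode_inverse)
    ultimately show ?thesis using m by blast
  qed
  have dichotomy: "cball (p j' i') (r j' i') \<subseteq> ball (p j i) (r j i) \<or>
      cball (p j i) (r j i) \<inter> cball (p j' i') (r j' i') = {}" if "j < j'" "i' < N j'" for j i j' i'
    using r(3)[OF that, of i] r2[of j' i'] by (intro cball_inside_or_disjoint) linarith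
  have disj_less: "cball (p j i) (r j i) \<inter> cball (p j' i') (r j' i') = {}"
    if "keep j i" "keep j' i'" "j < j'" for j i j' i'
    using dichotomy[OF that(3), of i' i] that unfolding keep_def by blast
  have disj_same: "cball (p j i) (r j i) \<inter> cball (p j i') (r j i') = {}"
    if "i < N j" "i' < N j" "i \<noteq> i'" for j i i'
  proof -
    \<comment> \<open>Within a group no choice of radii is needed: they are at most
      \<open>2 * l j\<close>, while the centres are more than \<open>4 * l j\<close> apart.\<close>
    have "r j i + r j i' < dist (p j i) (p j i')"
      using sep[OF that] r2[of j i] r2[of j i'] by linarith
    thus ?thesis by (rule disjoint_cballI)
  qed
  have disj: "cball (p j i) (r j i) \<inter> cball (p j' i') (r j' i') = {}"
    if "keep j i" "keep j' i'" "(j, i) \<noteq> (j', i')" for j i j' i'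
  proof -
    consider "j < j'" | "j' < j" | "j = j'" by linarith
    thus ?thesis
    proof cases
      case 1 thus ?thesis using disj_less that by blast
    next
      case 2 thus ?thesis using disj_less[of j' i' j i] that by blast
    next
      case 3
      thus ?thesis using disj_same[of i j i'] that by (simp add: keep_def)
    qed
  qed
  have Dn: "0 \<le> snd (D z)" for z using rpos by (cases z) (auto simp: DE less_imp_le)
  have "summable (\<lambda>n. snd (D (prod_decode n)))"
  proof (rule summable_prod_decode(1)[of "\<lambda>z. snd (D z)" N "\<lambda>j. 2 * l j"])
    show "summable (\<lambda>j. real (N j) * (2 * l j))"
      using summable_mult[OF sm, of 2] by (simp add: mult_ac)
  qed (use r2 l rpos in \<open>auto simp: DE keep_def less_imp_le\<close>)
  hence smB: "summable (\<lambda>n. snd (B (Suc n)))" by (simp add: BS)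
  have "classical_cheese B"
    unfolding classical_cheese_def
  proof (intro conjI ballI impI)
    show "abstract_swiss_cheese B"
      unfolding abstract_swiss_cheese_def
    proof
      fix n show "0 \<le> snd (B n)" using Dn s(1) by (cases n) (auto simp: B0 BS)
    qed
    show "0 < snd (B 0)" using s(1) by (simp add: B0)
  next
    fix k assume "k \<in> cheese_index B"
    then obtain j i where k: "k = Suc (prod_encode (j, i))" "keep j i" using idx by blast
    show "cball (fst (B k)) (snd (B k)) \<subseteq> ball (fst (B 0)) (snd (B 0))"
      using k(2) by (simp add: k(1) B0 BS DE keep_def)
    fix k' assume "k' \<in> cheese_index B" "k' \<noteq> k"
    then obtain j' i' where k': "k' = Suc (prod_encode (j', i'))" "keep j' i'" using idx by blast
    have "(j, i) \<noteq> (j', i')" using \<open>k' \<noteq> k\<close> k k' by auto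
    thus "cball (fst (B k)) (snd (B k)) \<inter> cball (fst (B k')) (snd (B k')) = {}"
      using disj[OF k(2) k'(2)] k k' by (simp add: BS DE)
  qed (rule smB)
  \<comment> \<open>Strong induction on the group: a dropped disk either misses the outer disk or
    lies in a disk of an earlier group, which is already known to miss the cheese.\<close>
  moreover have cover: "cheese_set B \<inter> ball (p j i) (r j i) = {}" if "i < N j" for j i
    using that
  proof (induction j arbitrary: i rule: less_induct)
    case (less j)
    have "cball (p j i) (r j i) \<subseteq> ball 0 s \<or> cball 0 s \<inter> cball (p j i) (r j i) = {}"
      using s(2)[OF less.prems] r2[of j i] by (intro cball_inside_or_disjoint) linarith
    then consider "cball 0 s \<inter> cball (p j i) (r j i) = {}" | "keep j i" |
      j' i' where "j' < j" "i' < N j'" "cball (p j i) (r j i) \<subseteq> ball (p j' i') (r j' i')"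
      using less.prems unfolding keep_def by blast
    thus ?case
    proof cases
      case 1
      moreover have "cheese_set B \<subseteq> cball 0 s" by (simp add: cheese_set_def B0)
      moreover have "ball (p j i) (r j i) \<subseteq> cball (p j i) (r j i)" by (rule ball_subset_cball)
      ultimately show ?thesis by blast
    next
      case 2
      hence "B (Suc (prod_encode (j, i))) = (p j i, r j i)" by (simp add: BS DE)
      moreover have "ball (fst (B (Suc n))) (snd (B (Suc n))) \<subseteq>
          (\<Union>n\<in>{1..}. ball (fst (B n)) (snd (B n)))" for n
        by (rule UN_upper) simp
      ultimately have "ball (p j i) (r j i) \<subseteq> (\<Union>n\<in>{1..}. ball (fst (B n)) (snd (B n)))"
        by (metis fst_conv snd_conv)
      thus ?thesis unfolding cheese_set_def by blast
    next
      case 3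
      have "ball (p j i) (r j i) \<subseteq> cball (p j i) (r j i)" by (rule ball_subset_cball)
      thus ?thesis using less.IH[OF 3(1,2)] 3(3) by blast
    qed
  qed
  moreover have "cheese_set B \<inter> ball (p j i) (l j) = {}" if "i < N j" for j i
    using cover[OF that] subset_ball[OF r(1)[of j i], of "p j i"] by blast
  moreover have "B (Suc (prod_encode (j, i))) = (0, 0) \<or>
       i < N j \<and> fst (B (Suc (prod_encode (j, i)))) = p j i \<and>
       0 < snd (B (Suc (prod_encode (j, i)))) \<and> snd (B (Suc (prod_encode (j, i)))) \<le> 2 * l j" for j i
    using r2[of j i] rpos[of j i] by (simp add: BS DE keep_def)
  ultimately show ?thesis using B0 by (intro exI[of _ B]) simp
qed

text \<open>The bounds in terms of the index \<open>m\<close> can be met because every disk is enumerated infinitely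
  often and is replaced by the unit disk for as long as \<open>m\<close> is too small for it.\<close>

lemma countable_disk_base:
  "\<exists>(c :: nat \<Rightarrow> complex) \<rho>.
    (\<forall>m. 2 / real (m + 2) \<le> \<rho> m \<and> \<rho> m \<le> 1 \<and> 2 / real (m + 2) \<le> \<bar>cmod (c m) - \<rho> m\<bar>) \<and>
    (\<forall>x e. 0 < e \<longrightarrow> (\<exists>m. x \<in> ball (c m) (\<rho> m) \<and> ball (c m) (\<rho> m) \<subseteq> ball x e))"
proof -
  obtain Q :: "(complex \<times> real) set" where Q: "countable Q"
    "\<And>U. open U \<Longrightarrow> U \<noteq> {} \<Longrightarrow> \<exists>d\<in>Q. d \<in> U"
    using countable_dense_setE by blast
  have "Q \<noteq> {}" using Q(2)[of UNIV] by auto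
  define g where "g = from_nat_into Q"
  define ok where "ok m z \<longleftrightarrow> 2 / real (m + 2) \<le> snd z \<and> snd z \<le> 1 \<and>
    2 / real (m + 2) \<le> \<bar>cmod (fst z) - snd z\<bar>" for m :: nat and z :: "complex \<times> real"
  \<comment> \<open>The fallback is the unit disk about 0, which satisfies \<open>ok m\<close> for
    every \<open>m\<close>.\<close>
  define G where "G m = (let z = g (fst (prod_decode m)) in if ok m z then z else (0, 1))" for m
  have ok1: "ok m (0, 1)" for m by (simp add: ok_def)
  have okG: "ok m (G m)" for m using ok1 by (simp add: G_def Let_def)
  have "\<exists>m. x \<in> ball (fst (G m)) (snd (G m)) \<and> ball (fst (G m)) (snd (G m)) \<subseteq> ball x e"
    if e: "0 < e" for x e
  proof -
    define U where "U = {z. dist x (fst z) < snd z \<and> snd z < e / 2 \<and> snd z < 1 \<and> cmod (fst z) \<noteq> snd z}"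
    have "open U" unfolding U_def
      by (intro open_Collect_conj open_Collect_less open_Collect_neq continuous_intros)
    \<comment> \<open>The set \<open>U\<close> contains a disk about \<open>x\<close> of radius
      \<open>min (e/4) (1/2)\<close>, halved in case its boundary would pass through 0.\<close>
    moreover have "(x, if cmod x = min (e/4) (1/2) then min (e/4) (1/2) / 2 else min (e/4) (1/2)) \<in> U"
      using e by (auto simp: U_def)
    ultimately obtain z where z: "z \<in> Q" "z \<in> U" using Q(2)[of U] by blast
    then obtain a where a: "g a = z" unfolding g_def using from_nat_into_surj[OF Q(1)] by blast
    have pos: "0 < snd z" using z(2) le_less_trans[OF zero_le_dist[of x "fst z"]] by (simp add: U_def)
    define t where "t = min (snd z) \<bar>cmod (fst z) - snd z\<bar>"
    have t: "0 < t" using pos z(2) by (simp add: t_def U_def)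
    obtain b :: nat where b: "2 / t < real b" using reals_Archimedean2 by blast
    \<comment> \<open>The second component \<open>b\<close> only serves to make the index so large
      that the margin \<open>2 / (m + 2)\<close> drops below \<open>t\<close>.\<close>
    define m where "m = prod_encode (a, b)"
    have "b \<le> m" unfolding m_def by (rule le_prod_encode_2)
    hence "2 / t < real (m + 2)" using b by linarith
    hence "2 / real (m + 2) \<le> t" using t by (simp add: field_simps)
    hence "ok m z" using z(2) by (simp add: ok_def t_def U_def)
    hence Gm: "G m = z" by (simp add: G_def m_def a)
    have "ball (fst z) (snd z) \<subseteq> ball x e"
    proof
      fix y assume "y \<in> ball (fst z) (snd z)"
      thus "y \<in> ball x e" using z(2) dist_triangle[of x y "fst z"] by (simp add: U_def)
    qed
    thus ?thesis using z(2) Gm by (intro exI[of _ m]) (simp add: U_def dist_commute)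
  qed
  thus ?thesis
    using okG by (intro exI[of _ "\<lambda>m. fst (G m)"] exI[of _ "\<lambda>m. snd (G m)"]) (simp add: ok_def)
qed

section \<open>The regular Swiss cheese\<close>

text \<open>Since \<open>n\<ge>1\<close> gives (i + n)^2 \<ge> n^2 + i, the series is dominated by a
  geometric one with ratio 1/2.\<close>

lemma inverse_square_exponent_sum:
  assumes "1 \<le> n"
  shows "summable (\<lambda>i. 1 / 2 ^ (i + n)\<^sup>2 :: real)"
    and "(\<Sum>i. 1 / 2 ^ (i + n)\<^sup>2 :: real) \<le> 2 / 2 ^ n\<^sup>2"
proof -
  have le: "1 / 2 ^ (i + n)\<^sup>2 \<le> 1 / 2 ^ n\<^sup>2 * (1/2 :: real) ^ i" for i
  proof -
    have "i * 1 \<le> i * (i + 2 * n)" using assms by (intro mult_left_mono) auto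
    hence "n\<^sup>2 + i \<le> (i + n)\<^sup>2" by (simp add: power2_eq_square algebra_simps)
    hence "(2::real) ^ (n\<^sup>2 + i) \<le> 2 ^ (i + n)\<^sup>2" by (rule power_increasing) simp
    hence "1 / 2 ^ (i + n)\<^sup>2 \<le> 1 / (2::real) ^ (n\<^sup>2 + i)" by (rule divide_left_mono) auto
    thus ?thesis by (simp add: power_add power_divide)
  qed
  have g: "summable (\<lambda>i. 1 / 2 ^ n\<^sup>2 * (1/2 :: real) ^ i)"
    by (intro summable_mult summable_geometric) simp
  show s: "summable (\<lambda>i. 1 / 2 ^ (i + n)\<^sup>2 :: real)"
    by (rule summable_comparison_test'[OF g]) (use le in simp)
  have "(\<Sum>i. 1 / 2 ^ (i + n)\<^sup>2 :: real) \<le> (\<Sum>i. 1 / 2 ^ n\<^sup>2 * (1/2 :: real) ^ i)"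
    by (rule suminf_le[OF le s g])
  also have "\<dots> = 1 / 2 ^ n\<^sup>2 * (\<Sum>i. (1/2 :: real) ^ i)"
    by (rule suminf_mult) (simp add: summable_geometric)
  also have "\<dots> = 2 / 2 ^ n\<^sup>2" by (subst suminf_geometric) auto
  finally show "(\<Sum>i. 1 / 2 ^ (i + n)\<^sup>2 :: real) \<le> 2 / 2 ^ n\<^sup>2" .
qed

lemma R_alg_cmult:
  assumes "f \<in> R_alg X"
  shows "(\<lambda>z. a * f z) \<in> R_alg X"
proof -
  have "\<exists>p q. (\<forall>z\<in>X. poly q z \<noteq> 0) \<and> (\<forall>z\<in>X. cmod (a * f z - poly p z / poly q z) < e)"
    if e: "0 < e" for e
  proof -
    have "0 < e / (cmod a + 1)" using e by (simp add: add_nonneg_pos)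
    moreover have "\<forall>e>0. \<exists>p q. (\<forall>z\<in>X. poly q z \<noteq> 0) \<and> (\<forall>z\<in>X. cmod (f z - poly p z / poly q z) < e)"
      using assms by (simp add: R_alg_def)
    ultimately have "\<exists>p q. (\<forall>z\<in>X. poly q z \<noteq> 0) \<and>
        (\<forall>z\<in>X. cmod (f z - poly p z / poly q z) < e / (cmod a + 1))"
      by (simp only: simp_thms)
    then obtain p q where q: "\<forall>z\<in>X. poly q z \<noteq> 0"
      and pq: "\<forall>z\<in>X. cmod (f z - poly p z / poly q z) < e / (cmod a + 1)"
      by (elim exE conjE)
    have "cmod (a * f z - poly (smult a p) z / poly q z) < e" if "z \<in> X" for z
    proof -
      have "a * f z - poly (smult a p) z / poly q z = a * (f z - poly p z / poly q z)"
        by (simp add: algebra_simps)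
      hence "cmod (a * f z - poly (smult a p) z / poly q z) = cmod a * cmod (f z - poly p z / poly q z)"
        by (simp add: norm_mult)
      also have "\<dots> \<le> cmod a * (e / (cmod a + 1))"
        using pq that by (intro mult_left_mono) (auto simp: less_imp_le)
      also have "\<dots> < e"
      proof -
        have pos: "0 < cmod a + 1" by (simp add: add_nonneg_pos)
        have "cmod a * e < e * (cmod a + 1)" using e by (simp add: algebra_simps)
        thus ?thesis using pos by (simp add: pos_divide_less_eq)
      qed
      finally show ?thesis .
    qed
    thus ?thesis using q by (intro exI[of _ "smult a p"] exI[of _ q] conjI ballI) simp_all
  qed
  moreover have "continuous_on X (\<lambda>z. a * f z)"
    using assms by (auto simp: R_alg_def intro: continuous_on_mult_left)
  ultimately show ?thesis using assms by (simp add: R_alg_def)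
qed

lemma R_regularI:
  assumes "\<And>x e. x \<in> X \<Longrightarrow> 0 < e \<Longrightarrow> \<exists>f\<in>R_alg X. f x \<noteq> 0 \<and> (\<forall>z\<in>X. z \<notin> ball x e \<longrightarrow> f z = 0)"
  shows "R_regular X"
  unfolding R_regular_def
proof (intro allI impI)
  fix E x assume E: "E \<subseteq> X \<and> closed E \<and> x \<in> X - E"
  hence "open (- E)" "x \<in> - E" by auto
  then obtain e where e: "0 < e" "ball x e \<subseteq> - E" by (auto simp: open_contains_ball simp del: mem_ball)
  have "x \<in> X" using E by simp
  from assms[OF this e(1)] obtain f where f: "f \<in> R_alg X" "f x \<noteq> 0"
    and f0: "\<forall>z\<in>X. z \<notin> ball x e \<longrightarrow> f z = 0"
    by (elim bexE conjE)
  have "(\<lambda>z. (1 / f x) * f z) \<in> R_alg X" by (rule R_alg_cmult[OF f(1)])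
  moreover have "(1 / f x) * f x = 1" using f(2) by simp
  moreover have "\<forall>y\<in>E. (1 / f x) * f y = 0"
  proof
    fix y assume "y \<in> E"
    hence "y \<in> X" "y \<notin> ball x e" using E e(2) by auto
    thus "(1 / f x) * f y = 0" using f0 by simp
  qed
  ultimately show "\<exists>f\<in>R_alg X. f x = 1 \<and> (\<forall>y\<in>E. f y = 0)" by (intro bexI conjI)
qed

text \<open>As \<open>b \<le> 1\<close>, the ratio is at most \<open>1 - (b - a)\<close>, hence at
  most the exponential of \<open>- 1 / (2 * n ^ 3)\<close>; the power \<open>2 ^ n\<close> then
  produces the left side of \<open>growth\<close>.\<close>

lemma ratio_power_bound:
  fixes a b :: real
  assumes n: "0 < n" and growth: "exp (- (2 ^ n / (2 * real n ^ 3))) \<le> 1 / 2 ^ (4 * n\<^sup>2 + n + 4)"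
    and ab: "0 < a" "a < b" "b \<le> 1" "1 / (2 * real n ^ 3) \<le> b - a"
  shows "(a / b) ^ (2 ^ n) \<le> 1 / 2 ^ (4 * n\<^sup>2 + n + 4)"
proof -
  define \<mu> where "\<mu> = 1 / (2 * real n ^ 3)"
  have "b - a \<le> (b - a) / b" using ab by (simp add: le_divide_eq mult_left_le)
  also have "\<dots> = 1 - a / b" using ab by (simp add: diff_divide_distrib)
  finally have "a / b \<le> 1 - \<mu>" using ab(4) by (simp add: \<mu>_def)
  also have "\<dots> \<le> exp (- \<mu>)" using exp_ge_add_one_self[of "- \<mu>"] by simp
  finally have "(a / b) ^ (2 ^ n) \<le> exp (- \<mu>) ^ (2 ^ n)"
    using ab by (intro power_mono) auto
  also have "\<dots> = exp (- (2 ^ n / (2 * real n ^ 3)))"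
    by (simp add: exp_of_nat_mult[symmetric] \<mu>_def)
  finally show ?thesis using growth by linarith
qed

lemma sum_le_prod_encode: "m + k \<le> prod_encode (m, k)"
proof -
  have "s \<le> triangle s" for s by (induction s) auto
  from this[of "m + k"] show ?thesis by (simp add: prod_encode_def)
qed

text \<open>Moving to the next circle of the same disk therefore at most doubles the shifted group
  index.\<close>

lemma prod_encode_Suc_right: "prod_encode (m, Suc k) = prod_encode (m, k) + m + k + 1"
  by (simp add: prod_encode_def)

text \<open>The shift \<open>\<kappa>\<close> makes the doubly exponential decay in
  \<open>growth\<close> available from the first group on, and it makes the sum of the radii as
  small as desired.\<close>

locale disk_system =
  fixes c :: "nat \<Rightarrow> complex" and \<rho> :: "nat \<Rightarrow> real" and \<kappa> :: nat
  assumes rho: "\<And>m. 2 / real (m + 2) \<le> \<rho> m" "\<And>m. \<rho> m \<le> 1"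
    and rho_gap: "\<And>m. 2 / real (m + 2) \<le> \<bar>cmod (c m) - \<rho> m\<bar>"
    and base: "\<And>x e. 0 < e \<Longrightarrow> \<exists>m. x \<in> ball (c m) (\<rho> m) \<and> ball (c m) (\<rho> m) \<subseteq> ball x e"
    and kappa: "4 \<le> \<kappa>"
    and growth: "\<And>n. \<kappa> \<le> n \<Longrightarrow> exp (- (2 ^ n / (2 * real n ^ 3))) \<le> 1 / 2 ^ (4 * n\<^sup>2 + n + 4)"
begin

text \<open>Group \<open>j\<close> of holes, where \<open>j\<close> encodes \<open>(m, k)\<close>, surrounds the \<open>N j\<close> equidistributed points on the
  \<open>k\<close>-th circle for the disk with index \<open>m\<close>. With \<open>n = j + \<kappa>\<close>, a factor decays like
  \<open>exp (- 2 ^ n / (2 * n ^ 3))\<close> between successive circles of the same disk. The next circle has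
  group index at most \<open>2 * n\<close>, so its factor is bounded by \<open>4 * 2 ^ (4 * n ^ 2)\<close>, which this decay
  outweighs.\<close>

definition d :: "nat \<Rightarrow> real" where "d m = 1 / real (m + 2)"
definition R :: "nat \<Rightarrow> nat \<Rightarrow> real" where "R m k = \<rho> m - d m / real (k + 1)"
definition M :: "nat \<Rightarrow> nat \<Rightarrow> real" where "M m k = (R m k + R m (Suc k)) / 2"
definition N :: "nat \<Rightarrow> nat" where "N j = 2 ^ (j + \<kappa>)"
text \<open>With \<open>n = j + \<kappa>\<close> the exponent gives \<open>N j * l j\<close> the
  value 2^(-n^2), which beats every power of \<open>n\<close>, while one radius \<open>l j\<close>
  still outweighs all later groups.\<close>

definition l :: "nat \<Rightarrow> real" where "l j = 1 / 2 ^ ((j + \<kappa>)\<^sup>2 + (j + \<kappa>))"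
definition p :: "nat \<Rightarrow> nat \<Rightarrow> complex" where
  "p j i = (case prod_decode j of (m, k) \<Rightarrow> c m + R m k * cis (2 * pi * real i / real (N j)))"

section \<open>Radii of the circles of poles\<close>

lemma d_pos: "0 < d m" by (simp add: d_def)

lemma d_le: "d m / real (k + 1) \<le> d m"
  using d_pos[of m] by (simp add: divide_le_eq mult_le_cancel_left1)

lemma d_le_R: "d m \<le> R m k"
  using rho(1)[of m] d_le[of m k] by (simp add: R_def d_def)

lemma R_pos: "0 < R m k" using d_le_R d_pos by (rule less_le_trans[rotated])

lemma R_le_1: "R m k \<le> 1" using rho(2)[of m] divide_pos_pos[OF d_pos[of m], of "real (k + 1)"] by (simp add: R_def)

lemma R_diff: "R m (Suc k) - R m k = d m / (real (k + 1) * real (k + 2))"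
  by (simp add: R_def divide_simps) (simp add: algebra_simps)

lemma R_less: "R m k < R m (Suc k)"
proof -
  have "0 < d m / (real (k + 1) * real (k + 2))"
    by (intro divide_pos_pos mult_pos_pos d_pos) simp_all
  thus ?thesis using R_diff[of m k] by linarith
qed

lemma M_between: "R m k < M m k" "M m k < R m (Suc k)"
  using R_less[of m k] by (auto simp: M_def)

text \<open>Consecutive radii differ by \<open>d m / ((k + 1) * (k + 2))\<close>, at least
  \<open>1 / n ^ 3\<close>, and \<open>M m k\<close> halves this step. The result has the form
  required by \<open>ratio_power_bound\<close>.\<close>

lemma half_step:
  assumes "m + 2 \<le> n" "k + 2 \<le> n"
  shows "1 / (2 * real n ^ 3) \<le> M m k - R m k" "1 / (2 * real n ^ 3) \<le> R m (Suc k) - M m k"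
proof -
  have "1 / real n \<le> d m" unfolding d_def using assms by (intro divide_left_mono) auto
  moreover have "real (k + 1) * real (k + 2) \<le> real n * real n"
    using assms by (intro mult_mono) auto
  ultimately have "(1 / real n) / (real n * real n) \<le> d m / (real (k + 1) * real (k + 2))"
    using assms d_pos[of m] by (intro frac_le) (auto simp: less_imp_le)
  hence "1 / real n ^ 3 \<le> R m (Suc k) - R m k" by (simp add: R_diff power3_eq_cube mult.assoc)
  thus "1 / (2 * real n ^ 3) \<le> M m k - R m k" "1 / (2 * real n ^ 3) \<le> R m (Suc k) - M m k"
    by (auto simp: M_def field_simps)
qed

lemma M_tendsto: "M m \<longlonglongrightarrow> \<rho> m"
proof -
  have "M m k = \<rho> m - (d m / real (k + 1) + d m / real (k + 2)) / 2" for k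
  proof -
    have half: "(r - a + (r - b)) / 2 = r - (a + b) / 2" for r a b :: real by (simp add: field_simps)
    have "Suc k + 1 = k + 2" by simp
    thus ?thesis by (simp only: M_def R_def half)
  qed
  hence "M m = (\<lambda>k. \<rho> m - (d m / real (k + 1) + d m / real (k + 2)) / 2)" by blast
  moreover have "(\<lambda>k. \<rho> m - (d m / real (k + 1) + d m / real (k + 2)) / 2) \<longlonglongrightarrow> \<rho> m"
    by real_asymp
  ultimately show ?thesis by simp
qed

section \<open>Sizes, positions and separation of the holes\<close>

lemma N_l: "real (N j) * l j = 1 / 2 ^ (j + \<kappa>)\<^sup>2"
  by (simp add: N_def l_def power_add)

lemma l_pos: "0 < l j" by (simp add: l_def)

lemma l_small: "4 * real (j + \<kappa>) * l j < 2 / 2 ^ (j + \<kappa>)"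
proof -
  let ?n = "j + \<kappa>"
  have "real ?n < 2 ^ ?n" using of_nat_less_two_power[of ?n, where ?'a = real] by simp
  hence "2 * real ?n < 2 ^ (?n + 1)" by simp
  also have "\<dots> \<le> (2::real) ^ ?n\<^sup>2"
  proof (rule power_increasing)
    have "?n + 1 \<le> ?n * 4" using kappa by presburger
    also have "\<dots> \<le> ?n * ?n" using kappa by (intro mult_left_mono) auto
    finally show "?n + 1 \<le> ?n\<^sup>2" by (simp only: power2_eq_square)
  qed simp
  finally have "2 * real ?n * 2 < 2 ^ ?n\<^sup>2 * 2" by simp
  thus ?thesis by (simp add: l_def power_add divide_simps mult_ac)
qed

text \<open>The circle about \<open>c m\<close> of radius \<open>\<rho> m\<close> keeps the distance
  \<open>2 * d m\<close> from 0, and \<open>R m k\<close> differs from \<open>\<rho> m\<close> by at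
  most \<open>d m\<close>.\<close>

lemma centre_gap: "d m \<le> \<bar>cmod (c m) - R m k\<bar>"
proof -
  have "2 * d m \<le> \<bar>cmod (c m) - \<rho> m\<bar>" using rho_gap[of m] by (simp add: d_def)
  moreover have "0 < d m / real (k + 1)" using d_pos[of m] by simp
  ultimately show ?thesis using d_le[of m k] unfolding R_def by linarith
qed

lemma norm_p: "1 / real (j + \<kappa>) \<le> cmod (p j i)"
proof -
  obtain m k where mk: "prod_decode j = (m, k)" by fastforce
  hence j: "j = prod_encode (m, k)" by (metis prod_decode_inverse)
  have "m \<le> j" unfolding j by (rule le_prod_encode_1)
  hence "1 / real (j + \<kappa>) \<le> d m" unfolding d_def using kappa by (intro divide_left_mono) auto
  also have "\<dots> \<le> \<bar>cmod (c m) - R m k\<bar>" by (rule centre_gap)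
  also have "\<dots> \<le> cmod (p j i)"
    using norm_triangle_ineq3[of "c m" "- (R m k * cis (2 * pi * real i / real (N j)))"] R_pos[of m k]
    by (simp add: p_def mk norm_mult)
  finally show ?thesis .
qed

text \<open>Distinct roots of unity of order \<open>N j\<close> are at least \<open>2 / N j\<close>
  apart, and scaling by \<open>R m k\<close> costs at most the factor
  \<open>1 / (j + \<kappa>)\<close>. By \<open>l_small\<close> this still exceeds
  \<open>4 * l j\<close>.\<close>

lemma p_separated:
  assumes i: "i < N j" "i' < N j" "i \<noteq> i'"
  shows "4 * l j < dist (p j i) (p j i')"
proof -
  obtain m k where mk: "prod_decode j = (m, k)" by fastforce
  hence j: "j = prod_encode (m, k)" by (metis prod_decode_inverse)
  define w where "w i = cis (2 * pi * real i / real (N j))" for i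
  have N0: "0 < N j" by (simp add: N_def)
  have bij: "bij_betw w {..<N j} {z. z ^ N j = 1}"
    using Complex.bij_betw_roots_unity[OF N0] by (simp add: w_def[abs_def])
  have ne: "w i \<noteq> w i'" using bij i unfolding bij_betw_def inj_on_def by blast
  have wN: "w i ^ N j = 1" "w i' ^ N j = 1"
    using bij i unfolding bij_betw_def by blast+
  have w0: "w i' \<noteq> 0" "cmod (w i') = 1" by (simp_all add: w_def)
  have "2 \<le> real (N j) * cmod (w i / w i' - 1)"
    using wN ne w0 by (intro roots_of_unity_separated[OF N0]) (auto simp: power_divide)
  also have "w i / w i' - 1 = (w i - w i') / w i'" using w0 by (simp add: diff_divide_distrib)
  also have "cmod \<dots> = cmod (w i - w i')" using w0 by (simp add: norm_divide)
  finally have sep: "2 / real (N j) \<le> cmod (w i - w i')" using N0 by (simp add: field_simps)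
  have "m \<le> j" unfolding j by (rule le_prod_encode_1)
  hence "1 / real (j + \<kappa>) \<le> d m" unfolding d_def using kappa by (intro divide_left_mono) auto
  hence R: "1 / real (j + \<kappa>) \<le> R m k" using d_le_R[of m k] by linarith
  have n0: "0 < real (j + \<kappa>)" using kappa by simp
  have "y = 4 * x * (y / 4) / x" if "0 < x" for x y :: real using that by simp
  from this[OF n0, of "4 * l j"] have "4 * l j = 4 * real (j + \<kappa>) * l j / real (j + \<kappa>)"
    by (simp only: nonzero_mult_div_cancel_left[OF zero_neq_numeral[symmetric]])
  also have "\<dots> < 2 / 2 ^ (j + \<kappa>) / real (j + \<kappa>)"
    by (rule divide_strict_right_mono[OF l_small n0])
  also have "\<dots> = 1 / real (j + \<kappa>) * (2 / real (N j))" by (simp add: N_def)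
  finally have "4 * l j < 1 / real (j + \<kappa>) * (2 / real (N j))" .
  also have "\<dots> \<le> R m k * cmod (w i - w i')"
    using R sep R_pos[of m k] by (intro mult_mono) auto
  also have "\<dots> = cmod (R m k * (w i - w i'))" using R_pos[of m k] by (simp add: norm_mult)
  also have "\<dots> = dist (p j i) (p j i')"
    by (simp add: p_def mk dist_norm w_def algebra_simps)
  finally show ?thesis .
qed

lemma summable_N_l: "summable (\<lambda>j. real (N j) * l j)"
  unfolding N_l using kappa by (intro inverse_square_exponent_sum) simp

lemma sum_N_l: "(\<Sum>j. real (N j) * l j) \<le> 2 / 2 ^ \<kappa>\<^sup>2"
  unfolding N_l using kappa by (intro inverse_square_exponent_sum) simp

text \<open>With \<open>n = j + \<kappa>\<close> the tail is at most 2 / 2^((n + 1)^2). The exponent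
  exceeds n^2 + n by n + 1 > 3, which absorbs the constant 8.\<close>

lemma tail_N_l: "4 * (\<Sum>i. real (N (i + Suc j)) * l (i + Suc j)) < l j"
proof -
  let ?n = "j + \<kappa>"
  have "(\<Sum>i. real (N (i + Suc j)) * l (i + Suc j)) = (\<Sum>i. 1 / 2 ^ (i + Suc ?n)\<^sup>2)"
    unfolding N_l by (simp add: ac_simps)
  also have "\<dots> \<le> 2 / 2 ^ (Suc ?n)\<^sup>2" by (rule inverse_square_exponent_sum) simp
  finally have "4 * (\<Sum>i. real (N (i + Suc j)) * l (i + Suc j)) \<le> 2 ^ 3 / 2 ^ (Suc ?n)\<^sup>2" by simp
  also have "\<dots> < l j"
  proof -
    have "3 + (?n\<^sup>2 + ?n) < (Suc ?n)\<^sup>2" using kappa by (simp add: power2_eq_square)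
    hence "(2::real) ^ (3 + (?n\<^sup>2 + ?n)) < 2 ^ (Suc ?n)\<^sup>2" by (rule power_strict_increasing) simp
    thus ?thesis unfolding l_def by (simp add: power_add divide_simps)
  qed
  finally show ?thesis .
qed

lemma total_N_l: "4 * (\<Sum>j. real (N j) * l j) < 1"
proof -
  have "4 * 1 \<le> \<kappa> * \<kappa>" using kappa by (intro mult_mono) auto
  hence "4 \<le> \<kappa>\<^sup>2" by (simp add: power2_eq_square)
  hence "(2::real) ^ 4 \<le> 2 ^ \<kappa>\<^sup>2" by (rule power_increasing) simp
  hence "2 / 2 ^ \<kappa>\<^sup>2 \<le> 2 / (2::real) ^ 4" by (intro divide_left_mono) auto
  also have "\<dots> = 1 / 8" by simp
  finally show ?thesis using sum_N_l by linarith
qed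

text \<open>The weight bounds the inverse \<open>q\<close>-th power of the distance from 0 to a hole
  of group \<open>j\<close>; being polynomial, it cannot offset the decay of
  \<open>N j * l j\<close>.\<close>

lemma weighted_summable_N_l:
  "summable (\<lambda>j. real (N j) * (2 * l j * (2 * real (j + \<kappa>)) ^ q))"
proof -
  have "\<forall>\<^sub>F n :: nat in sequentially. (2 * real n) ^ q / 2 ^ n\<^sup>2 \<le> (1/2) ^ n" by real_asymp
  hence "\<forall>\<^sub>F n :: nat in sequentially. norm ((2 * real n) ^ q / 2 ^ n\<^sup>2) \<le> (1/2) ^ n" by simp
  hence "summable (\<lambda>n. (2 * real n) ^ q / 2 ^ n\<^sup>2)"
    by (rule summable_comparison_test_ev) (simp add: summable_geometric)
  hence "summable (\<lambda>j. 2 * ((2 * real (j + \<kappa>)) ^ q / 2 ^ (j + \<kappa>)\<^sup>2))"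
    by (intro summable_mult) (rule summable_ignore_initial_segment)
  moreover have "real (N j) * (2 * l j * (2 * real (j + \<kappa>)) ^ q) =
      2 * ((2 * real (j + \<kappa>)) ^ q / 2 ^ (j + \<kappa>)\<^sup>2)" for j
  proof -
    have "real (N j) * (2 * l j * (2 * real (j + \<kappa>)) ^ q) =
        2 * ((real (N j) * l j) * (2 * real (j + \<kappa>)) ^ q)" by (simp only: mult_ac)
    thus ?thesis unfolding N_l by simp
  qed
  ultimately show ?thesis by simp
qed

text \<open>Around \<open>x\<close> a disk of the base is chosen inside \<open>ball x e\<close>. The
  zeros of the \<open>k\<close>-th denominator for this disk are the centres of one group of holes,
  so avoiding the holes bounds it from below.\<close>

lemma regular:
  assumes avoid: "\<And>j i. i < N j \<Longrightarrow> X \<inter> ball (p j i) (l j) = {}"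
  shows "R_regular X"
proof (rule R_regularI)
  fix x and e :: real assume x: "x \<in> X" and e: "0 < e"
  obtain m where m: "x \<in> ball (c m) (\<rho> m)" "ball (c m) (\<rho> m) \<subseteq> ball x e" using base[OF e] by blast
  define J where "J k = prod_encode (m, k)" for k
  \<comment> \<open>This is \<open>N (J k) * l (J k) / 4\<close>, the lower bound supplied by
    \<open>norm_one_minus_power_ge\<close>.\<close>
  define t where "t k = 1 / (2::real) ^ ((J k + \<kappa>)\<^sup>2 + 2)" for k
  have J: "m + 2 \<le> J k + \<kappa>" "k + 2 \<le> J k + \<kappa>" "J (Suc k) + \<kappa> \<le> 2 * (J k + \<kappa>)" for k
    using sum_le_prod_encode[of m k] kappa by (auto simp: J_def prod_encode_Suc_right)
  have "\<exists>f\<in>R_alg X. \<forall>z\<in>X. f z = 0 \<longleftrightarrow> z \<notin> ball (c m) (\<rho> m)"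
  proof (rule disk_function[where N = "\<lambda>k. N (J k)" and R = "R m" and M = "M m" and t = t])
    show "0 < N (J k)" for k by (simp add: N_def)
    show "0 < R m k" "R m k < M m k" "M m k < R m (Suc k)" for k by (rule R_pos M_between)+
    show "M m \<longlonglongrightarrow> \<rho> m" by (rule M_tendsto)
    show "0 < t k" for k by (simp add: t_def)
    show "t k \<le> 1" for k
      using one_le_power[of "2::real" "(J k + \<kappa>)\<^sup>2 + 2"] unfolding t_def
      by (meson divide_le_eq_1_pos less_le_trans one_le_numeral zero_less_one)
    show "t k \<le> cmod (1 - ((z - c m) / R m k) ^ N (J k))" if z: "z \<in> X" for k z
    proof -
      have "real (N (J k)) * l (J k) / 4 \<le> cmod (1 - ((z - c m) / R m k) ^ N (J k))"
      proof (rule norm_one_minus_power_ge)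
        show N0: "0 < N (J k)" by (simp add: N_def)
        show "real (N (J k)) * l (J k) \<le> 1" unfolding N_l by simp
        fix \<omega> :: complex assume "\<omega> ^ N (J k) = 1"
        then obtain i where i: "i < N (J k)" "\<omega> = cis (2 * pi * real i / real (N (J k)))"
          using Complex.bij_betw_roots_unity[OF N0] unfolding bij_betw_def by blast
        have "p (J k) i = c m + R m k * \<omega>" by (simp add: p_def J_def i(2))
        moreover have "z \<notin> ball (p (J k) i) (l (J k))" using avoid[OF i(1)] z by blast
        ultimately have "l (J k) \<le> cmod (z - c m - R m k * \<omega>)"
          by (simp add: dist_norm norm_minus_commute diff_diff_eq)
        also have "z - c m - R m k * \<omega> = R m k * ((z - c m) / R m k - \<omega>)"
          using R_pos[of m k] by (simp add: field_simps)
        also have "cmod \<dots> = R m k * cmod ((z - c m) / R m k - \<omega>)"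
          unfolding norm_mult using R_pos[of m k] by simp
        \<comment> \<open>Rescaling to the unit circle only increases distances, since
          \<open>R m k \<le> 1\<close>.\<close>
        also have "\<dots> \<le> cmod ((z - c m) / R m k - \<omega>)"
          using R_le_1[of m k] R_pos[of m k] by (intro mult_left_le_one_le) auto
        finally show "l (J k) \<le> cmod ((z - c m) / R m k - \<omega>)" .
      qed
      thus ?thesis unfolding N_l by (simp add: t_def power_add)
    qed
    show "(R m k / M m k) ^ N (J k) \<le> (1/2) ^ (k + 2) * t (Suc k)" for k
    proof -
      let ?n = "J k + \<kappa>" and ?n' = "J (Suc k) + \<kappa>"
      have "(R m k / M m k) ^ (2 ^ ?n) \<le> 1 / 2 ^ (4 * ?n\<^sup>2 + ?n + 4)"
        using M_between[of m k] R_le_1[of m "Suc k"] J[of k] kappa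
        by (intro ratio_power_bound growth R_pos half_step) auto
      also have "\<dots> \<le> 1 / 2 ^ (k + 2 + (?n'\<^sup>2 + 2))"
      \<comment> \<open>The next shifted index satisfies \<open>?n' \<le> 2 * ?n\<close>, hence the
        term \<open>4 * ?n\<^sup>2\<close> in \<open>growth\<close>; the remaining
        \<open>?n + 4\<close> pays for \<open>k + 4\<close>.\<close>
      proof (intro divide_left_mono power_increasing)
        have "?n'\<^sup>2 \<le> (2 * ?n)\<^sup>2" using J(3)[of k] by (rule power_mono) simp
        also have "(2 * ?n)\<^sup>2 = 4 * ?n\<^sup>2" by (subst power_mult_distrib) simp
        finally show "k + 2 + (?n'\<^sup>2 + 2) \<le> 4 * ?n\<^sup>2 + ?n + 4" using J(2)[of k] by linarith
      qed auto
      also have "\<dots> = (1/2) ^ (k + 2) * t (Suc k)" by (simp add: t_def power_add power_divide)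
      finally show ?thesis by (simp add: N_def)
    qed
    show "(M m k / R m (Suc k)) ^ N (J (Suc k)) \<le> (1/2) ^ (k + 4)" for k
    proof -
      let ?n = "J (Suc k) + \<kappa>"
      have "(M m k / R m (Suc k)) ^ (2 ^ ?n) \<le> 1 / 2 ^ (4 * ?n\<^sup>2 + ?n + 4)"
        using M_between[of m k] R_pos[of m k] R_le_1[of m "Suc k"] J[of "Suc k"] kappa
        by (intro ratio_power_bound growth half_step) auto
      also have "\<dots> \<le> 1 / 2 ^ (k + 4)"
        using J(2)[of "Suc k"] by (intro divide_left_mono power_increasing) auto
      finally show ?thesis by (simp add: N_def power_divide)
    qed
  qed
  thus "\<exists>f\<in>R_alg X. f x \<noteq> 0 \<and> (\<forall>z\<in>X. z \<notin> ball x e \<longrightarrow> f z = 0)"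
    using x m by (meson subsetD)
qed

lemma cheese_exists:
  "\<exists>B. classical_cheese B \<and> 0 \<in> cheese_set B \<and> cheese_rho B \<le> 4 / 2 ^ \<kappa>\<^sup>2 \<and>
     R_regular (cheese_set B) \<and> pointed_cheese B 0"
proof -
  obtain B where cl: "classical_cheese B" and B0: "fst (B 0) = 0"
    and avoid: "\<forall>j. \<forall>i<N j. cheese_set B \<inter> ball (p j i) (l j) = {}"
    and disk: "\<forall>j i. B (Suc (prod_encode (j, i))) = (0, 0) \<or>
       i < N j \<and> fst (B (Suc (prod_encode (j, i)))) = p j i \<and>
       0 < snd (B (Suc (prod_encode (j, i)))) \<and> snd (B (Suc (prod_encode (j, i)))) \<le> 2 * l j"
    using classical_cheese_selection[where p = p and N = N and l = l, OF l_pos summable_N_l tail_N_l total_N_l p_separated] by blast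
  define D where "D z = B (Suc (prod_encode z))" for z
  have D: "D (j, i) = (0, 0) \<or> i < N j \<and> fst (D (j, i)) = p j i \<and> 0 < snd (D (j, i)) \<and> snd (D (j, i)) \<le> 2 * l j"
    for j i using disk by (simp add: D_def)
  have BD: "B (Suc n) = D (prod_decode n)" for n by (simp add: D_def)
  have l2: "4 * l j \<le> 1 / real (j + \<kappa>)" for j
  proof -
    have "2 / (2::real) ^ (j + \<kappa>) \<le> 2 / 2 ^ 1"
      using kappa by (intro divide_left_mono power_increasing) auto
    also have "2 / (2::real) ^ 1 = 1" by simp
    finally have "4 * real (j + \<kappa>) * l j \<le> 1" using l_small[of j] by linarith
    hence "l j * 4 * real (j + \<kappa>) \<le> 1" by (simp only: mult_ac)
    moreover have "0 < real (j + \<kappa>)" using kappa by simp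
    ultimately show ?thesis by (simp only: pos_le_divide_eq mult.commute[of 4])
  qed
  \<comment> \<open>The centre has modulus at least \<open>1 / (j + \<kappa>)\<close>, and the
    radius, at most \<open>2 * l j\<close>, uses up at most half of that.\<close>
  have gap: "1 / (2 * real (j + \<kappa>)) \<le> dist 0 (fst (D (j, i))) - snd (D (j, i))"
    if "D (j, i) \<noteq> (0, 0)" for j i
  proof -
    have "1 / (2 * x) = 1 / x - 1 / x / 2" for x :: real by (cases "x = 0") (simp_all add: field_simps)
    hence "1 / (2 * real (j + \<kappa>)) = 1 / real (j + \<kappa>) - 1 / real (j + \<kappa>) / 2" .
    also have "\<dots> \<le> dist 0 (fst (D (j, i))) - snd (D (j, i))"
    proof -
      have "snd (D (j, i)) \<le> 2 * l j" and 1: "fst (D (j, i)) = p j i" using D[of j i] that by auto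
      hence 2: "2 * snd (D (j, i)) \<le> 1 / real (j + \<kappa>)" using l2[of j] by linarith
      have "y - y / 2 \<le> a - s" if "y \<le> a" "2 * s \<le> y" for y a s :: real using that by simp
      from this[OF norm_p[of j i] 2] show ?thesis using 1 by simp
    qed
    finally show ?thesis .
  qed
  interpret pointed_cheese B 0
  proof
    show "classical_cheese B" by (rule cl)
    show "0 \<in> ball (fst (B 0)) (snd (B 0))" using cl by (simp add: B0 classical_cheese_def)
  next
    fix k assume k: "k \<in> cheese_index B"
    then obtain n where n: "k = Suc n" by (cases k) (auto simp: cheese_index_def)
    obtain j i where ji: "prod_decode n = (j, i)" by fastforce
    have Bk: "B k = D (j, i)" by (simp add: n BD ji)
    hence "D (j, i) \<noteq> (0, 0)" using k by (auto simp: cheese_index_def)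
    from gap[OF this] have "0 < dist 0 (fst (D (j, i))) - snd (D (j, i))"
      using kappa by (elim less_le_trans[rotated]) simp
    thus "0 \<notin> cball (fst (B k)) (snd (B k))" by (simp add: Bk)
  next
    fix q
    let ?g = "\<lambda>z. snd (D z) / \<bar>dist 0 (fst (D z)) - snd (D z)\<bar> ^ Suc q"
    have "summable (\<lambda>n. ?g (prod_decode n))"
    proof (rule summable_prod_decode(1)[OF _ _ _ weighted_summable_N_l])
      show "0 \<le> ?g (j, i)" for j i using D[of j i] by (auto intro!: divide_nonneg_nonneg)
      show "?g (j, i) = 0" if "N j \<le> i" for j i using D[of j i] that by auto
      show "?g (j, i) \<le> 2 * l j * (2 * real (j + \<kappa>)) ^ Suc q" for j i
      proof (cases "D (j, i) = (0, 0)")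
        case True
        thus ?thesis using l_pos[of j] by simp
      next
        case False
        have pos: "0 < 1 / (2 * real (j + \<kappa>))" using kappa by simp
        have "?g (j, i) \<le> 2 * l j / (1 / (2 * real (j + \<kappa>))) ^ Suc q"
        proof (rule frac_le)
          show "(1 / (2 * real (j + \<kappa>))) ^ Suc q \<le> \<bar>dist 0 (fst (D (j, i))) - snd (D (j, i))\<bar> ^ Suc q"
            using gap[OF False] pos by (intro power_mono) linarith+
        qed (use D[of j i] False l_pos[of j] pos in \<open>auto simp del: power_Suc\<close>)
        thus ?thesis by (simp add: power_one_over field_simps)
      qed
    qed
    thus "summable (\<lambda>n. snd (B (Suc n)) / \<bar>dist 0 (fst (B (Suc n))) - snd (B (Suc n))\<bar> ^ Suc q)"
      by (simp add: BD)
  qed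
  have "cheese_rho B = (\<Sum>n. snd (D (prod_decode n)))" by (simp add: cheese_rho_def BD)
  also have "\<dots> \<le> (\<Sum>j. real (N j) * (2 * l j))"
  proof (rule summable_prod_decode(2))
    show "summable (\<lambda>j. real (N j) * (2 * l j))"
      using summable_mult[OF summable_N_l, of 2] by (simp add: mult_ac)
    show "0 \<le> snd (D (j, i))" for j i using D[of j i] by auto
    show "snd (D (j, i)) = 0" if "N j \<le> i" for j i using D[of j i] that by auto
    show "snd (D (j, i)) \<le> 2 * l j" for j i using D[of j i] l_pos[of j] by auto
  qed
  also have "\<dots> = 2 * (\<Sum>j. real (N j) * l j)"
    using suminf_mult[OF summable_N_l, of 2] by (simp add: mult_ac)
  also have "\<dots> \<le> 4 / 2 ^ \<kappa>\<^sup>2" using sum_N_l by simp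
  finally have "cheese_rho B \<le> 4 / 2 ^ \<kappa>\<^sup>2" .
  moreover have "R_regular (cheese_set B)" using avoid by (intro regular) blast
  ultimately show ?thesis using cl x_in_cheese pointed_cheese_axioms by blast
qed

end

section \<open>Choice of the shift and conclusion\<close>

theorem theorem8p6:
  fixes \<epsilon> :: real
  assumes "\<epsilon> > 0"
  shows "\<exists>B :: nat \<Rightarrow> complex \<times> real.
    abstract_swiss_cheese B \<and> classical_cheese B \<and>
    0 \<in> cheese_set B \<and> cheese_rho B < \<epsilon> \<and>
    R_regular (cheese_set B) \<and>
    (\<exists>d. point_derivation_inf (cheese_set B) 0 d \<and>
         bounded_derivation (cheese_set B) d \<and>
         nondegenerate_derivation (cheese_set B) d)"
proof -
  obtain c \<rho> where base: "\<forall>m. 2 / real (m + 2) \<le> \<rho> m \<and> \<rho> m \<le> 1 \<and>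
      2 / real (m + 2) \<le> \<bar>cmod (c m) - \<rho> m\<bar>"
    "\<forall>x e. 0 < e \<longrightarrow> (\<exists>m. x \<in> ball (c m) (\<rho> m) \<and> ball (c m) (\<rho> m) \<subseteq> ball x e)"
    using countable_disk_base by blast
  have "\<forall>\<^sub>F n :: nat in sequentially. exp (- (2 ^ n / (2 * real n ^ 3))) \<le> 1 / 2 ^ (4 * n\<^sup>2 + n + 4)"
    by real_asymp
  then obtain K1 where K1: "\<And>n. K1 \<le> n \<Longrightarrow>
      exp (- (2 ^ n / (2 * real n ^ 3))) \<le> 1 / 2 ^ (4 * n\<^sup>2 + n + 4)"
    by (auto simp: eventually_sequentially)
  have "\<forall>\<^sub>F n :: nat in sequentially. 4 / 2 ^ n\<^sup>2 < \<epsilon>" using assms by real_asymp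
  then obtain K2 where K2: "\<And>n. K2 \<le> n \<Longrightarrow> 4 / 2 ^ n\<^sup>2 < \<epsilon>"
    by (auto simp: eventually_sequentially)
  \<comment> \<open>Here 4 serves the elementary estimates, \<open>K1\<close> the decay of the
    factors, and \<open>K2\<close> the bound on the sum of the radii.\<close>
  define \<kappa> where "\<kappa> = max 4 (max K1 K2)"
  interpret disk_system c \<rho> \<kappa>
    by unfold_locales (use base K1 in \<open>simp_all add: \<kappa>_def del: mem_ball\<close>)
  obtain B where B: "classical_cheese B" "0 \<in> cheese_set B" "cheese_rho B \<le> 4 / 2 ^ \<kappa>\<^sup>2"
    "R_regular (cheese_set B)" "pointed_cheese B 0"
    using cheese_exists by blast
  interpret pointed_cheese B 0 by (rule B)
  have "4 / 2 ^ \<kappa>\<^sup>2 < \<epsilon>" by (rule K2) (simp add: \<kappa>_def)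
  hence "cheese_rho B < \<epsilon>" using B(3) by linarith
  moreover have "abstract_swiss_cheese B" using B(1) by (simp add: classical_cheese_def)
  ultimately show ?thesis using B taylor_functional_point_derivation taylor_functional_bounded
    taylor_functional_nondegenerate by blast
qed

end
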